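(* Let $|q|<1$. Let $G'(n)$ be the number of partitions of $n$ into parts of two colors (red and blue) in which the smallest part is odd, say equal to $2m+1$, and every red part is even and lies in the interval $(2m,4m]$; equivalently \[ \sum_{n=0}^\infty G'(n)q^n=\sum_{m=0}^\infty\frac{q^{2m+1}}{(q^{2m+1};q)_\infty(q^{2m+2};q^2)_m}. \] Let $\phi_3(q)=\sum_{n=0}^\infty\frac{q^{n^2}}{(-q^2;q^2)_n}$ be Ramanujan's third order mock theta function. Then \[ \sum_{n=0}^\infty G'(n)q^n=q^2-q(1+q)\phi_3(-q)+\frac{q(3-q)}{2(q;q)_\infty}+\frac{q(1+q)(q^2;q^2)_\infty}{2(-q;q)_\infty^3}. \]
   Context: For $N\ge1$, $(A;q)_N=(1-A)(1-Aq)\cdots(1-Aq^{N-1})$, $(A;q)_0=1$, and $(A;q)_\infty=\lim_{N\to\infty}(A;q)_N$. In the two-color partitions, parts of different colors are distinguished and the order of parts is irrelevant. *)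

theory Defs
  imports "HOL-Analysis.Analysis" "HOL-Library.Multiset"
begin

definition qpoch :: "complex \<Rightarrow> complex \<Rightarrow> nat \<Rightarrow> complex" where
  "qpoch a q N = (\<Prod>k<N. 1 - a * q ^ k)"

definition qpoch_inf :: "complex \<Rightarrow> complex \<Rightarrow> complex" where
  "qpoch_inf a q = lim (\<lambda>N. qpoch a q N)"

definition mock_phi3 :: "complex \<Rightarrow> complex" where
  "mock_phi3 q = (\<Sum>n. q ^ (n\<^sup>2) / qpoch (- (q\<^sup>2)) (q\<^sup>2) n)"

datatype color = Red | Blue

text \<open>A coloured part is a pair of its size and its colour; a multiset of coloured parts
  records a partition up to the order of its parts.\<close>

definition two_color_partitions :: "nat \<Rightarrow> (nat \<times> color) multiset set" where
  "two_color_partitions n =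
     {P. (\<forall>p\<in>#P. fst p > 0) \<and> sum_mset (image_mset fst P) = n}"

text \<open>The conditions imposed on the counted partitions. The smallest part is taken over both
  colours, and the empty partition, having no smallest part, is excluded.\<close>

definition G'_partition :: "(nat \<times> color) multiset \<Rightarrow> bool" where
  "G'_partition P \<longleftrightarrow>
     P \<noteq> {#} \<and>
     (\<exists>m. Min (fst ` set_mset P) = 2 * m + 1 \<and>
          (\<forall>k. (k, Red) \<in># P \<longrightarrow> even k \<and> k \<in> {2 * m <.. 4 * m}))"

definition G' :: "nat \<Rightarrow> nat" where
  "G' n = card {P \<in> two_color_partitions n. G'_partition P}"

end

(* With Q = q^2, the term of index m of the generating function is q / (q;q)_inf times
   Q^m (Q;Q)_m / ((-q;Q)_m (-Q;Q)_m). A telescoping recurrence in b, iterated along b, bQ, bQ^2, ...,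
   evaluates the series sum Q^n (Q;Q)_n / ((aQ;Q)_n (bQ;Q)_n) as a Lambert series plus an infinite
   product times sum (Q/a)^k (b;Q)_k. The latter sum is, up to elementary terms, one of the two halves
   of the bilateral series sum over all integers n of (-1)^n q^(n^2) / (-Q;Q)_n, the other half arising
   when a and b are exchanged. In the average of the two evaluations the Lambert series cancel, leaving
   the difference of the two halves: phi_3(-q) minus the half with n < 0. The bilateral series itself is
   an infinite product, by the q-difference equation that it satisfies in its denominator parameter,
   and this eliminates the half with n < 0. *)
theory Submission
  imports Defs
begin

subsection \<open>q-Pochhammer symbols\<close>

text \<open>In base Q = q^2 the parameters are a = -1 and b = -1/q, so that aQ = -Q and bQ = -q. One
  evaluation alone already yields phi_3(-q), but next to a Lambert series absent from the claim. The
  Lambert series of the two evaluations cancel because they come from the row and the column sums of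
  one double series, with terms (-1)^(j+n) q^((2j+1)(n+1)). The leftovers explain the constants:
  over both evaluations the rational terms add up to 3 - q, and each evaluation contributes q
  (q;q)_inf, which becomes the isolated q^2 after multiplication by q / (q;q)_inf. The q-difference
  equation in the denominator parameter x fixes the bilateral series only up to its value at x = 0.
  The point x = q^2, where the series is one-sided, supplies that constant. Term ratios in the half
  with n < 0 tend to x/q in absolute value, so the analysis is confined to |x| < |q|, a region that
  contains both q^2 and -q^2 when 0 < |q| < 1. Because -1/q occurs, q = 0 is split off at the
  end.\<close>

lemma qpoch_0 [simp]: "qpoch a q 0 = 1"
  by (simp add: qpoch_def)

lemma qpoch_Suc: "qpoch a q (Suc n) = qpoch a q n * (1 - a * q ^ n)"
  by (simp add: qpoch_def)

lemma qpoch_add: "qpoch a q (m + n) = qpoch a q m * qpoch (a * q ^ m) q n"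
  by (induction n) (simp_all add: qpoch_Suc power_add mult.assoc)

lemma qpoch_Suc_left: "qpoch a q (Suc n) = (1 - a) * qpoch (a * q) q n"
  using qpoch_add[of a q 1 n] by (simp add: qpoch_Suc)

lemma qpoch_nonzero: "(\<And>k. a * q ^ k \<noteq> 1) \<Longrightarrow> qpoch a q n \<noteq> 0"
  by (auto simp: qpoch_def)

lemma qpower_neq_1:
  fixes q x :: complex
  assumes "norm q < 1" "norm x < 1"
  shows "x * q ^ k \<noteq> 1"
proof -
  have "norm (x * q ^ k) \<le> norm x * 1"
    unfolding norm_mult norm_power using assms by (intro mult_left_mono power_le_one) auto
  thus ?thesis using assms by auto
qed

lemma qpoch_even_odd: "qpoch a q (2 * n) = qpoch a (q\<^sup>2) n * qpoch (a * q) (q\<^sup>2) n"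
  by (induction n) (simp_all add: qpoch_Suc power_mult [symmetric] algebra_simps)

lemma qpoch_square: "qpoch (a\<^sup>2) (q\<^sup>2) n = qpoch a q n * qpoch (- a) q n"
  by (induction n) (simp_all add: qpoch_Suc power_mult [symmetric] algebra_simps power2_eq_square
      power_add [symmetric] mult_2)

lemma convergent_prod_qpoch:
  fixes a q :: complex
  assumes "norm q < 1"
  shows "convergent_prod (\<lambda>k. 1 - a * q ^ k)"
proof -
  have "summable (\<lambda>k. norm a * norm q ^ k)"
    using assms by (intro summable_mult summable_geometric) simp
  hence "summable (\<lambda>k. norm ((1 - a * q ^ k) - 1))"
    by (simp add: norm_mult norm_power)
  hence "abs_convergent_prod (\<lambda>k. 1 - a * q ^ k)"
    by (rule summable_imp_abs_convergent_prod)
  thus ?thesis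
    by (rule abs_convergent_prod_imp_convergent_prod)
qed

lemma qpoch_tendsto:
  assumes "norm q < 1"
  shows "qpoch a q \<longlonglongrightarrow> qpoch_inf a q"
proof -
  have "qpoch a q \<longlonglongrightarrow> prodinf (\<lambda>k. 1 - a * q ^ k)"
    using convergent_prod_LIMSEQ[OF convergent_prod_qpoch[OF assms, of a]]
    unfolding qpoch_def by (simp add: LIMSEQ_lessThan_iff_atMost)
  thus ?thesis
    unfolding qpoch_inf_def using limI by metis
qed

lemma qpoch_infI: "norm q < 1 \<Longrightarrow> qpoch a q \<longlonglongrightarrow> l \<Longrightarrow> qpoch_inf a q = l"
  using LIMSEQ_unique qpoch_tendsto by blast

lemma qpoch_inf_nonzero:
  assumes "norm q < 1" "\<And>k. a * q ^ k \<noteq> 1"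
  shows "qpoch_inf a q \<noteq> 0"
proof -
  have "prodinf (\<lambda>k. 1 - a * q ^ k) \<noteq> 0"
    using assms by (intro prodinf_nonzero convergent_prod_qpoch) auto
  moreover have "qpoch a q \<longlonglongrightarrow> prodinf (\<lambda>k. 1 - a * q ^ k)"
    using convergent_prod_LIMSEQ[OF convergent_prod_qpoch[OF assms(1), of a]]
    unfolding qpoch_def by (simp add: LIMSEQ_lessThan_iff_atMost)
  ultimately show ?thesis
    using qpoch_infI[OF assms(1)] by metis
qed

lemma qpoch_inf_split:
  assumes "norm q < 1"
  shows "qpoch_inf a q = qpoch a q n * qpoch_inf (a * q ^ n) q"
proof (rule qpoch_infI[OF assms])
  have "(\<lambda>k. qpoch a q (k + n)) \<longlonglongrightarrow> qpoch a q n * qpoch_inf (a * q ^ n) q"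
    unfolding add.commute[of _ n] qpoch_add by (intro tendsto_intros qpoch_tendsto assms)
  thus "qpoch a q \<longlonglongrightarrow> qpoch a q n * qpoch_inf (a * q ^ n) q"
    by (rule LIMSEQ_offset)
qed

lemma norm_power2_less_1: "norm (q :: complex) < 1 \<Longrightarrow> norm (q\<^sup>2) < 1"
  by (simp add: norm_power power_less_one_iff)

lemma qpoch_inf_even_odd:
  assumes "norm q < 1"
  shows "qpoch_inf a q = qpoch_inf a (q\<^sup>2) * qpoch_inf (a * q) (q\<^sup>2)"
proof -
  have "(\<lambda>n. qpoch a q (2 * n)) \<longlonglongrightarrow> qpoch_inf a (q\<^sup>2) * qpoch_inf (a * q) (q\<^sup>2)"
    unfolding qpoch_even_odd by (intro tendsto_intros qpoch_tendsto norm_power2_less_1 assms)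
  moreover have "(\<lambda>n. qpoch a q (2 * n)) \<longlonglongrightarrow> qpoch_inf a q"
    by (rule filterlim_compose[OF qpoch_tendsto[OF assms]])
       (auto intro!: filterlim_subseq simp: strict_mono_def)
  ultimately show ?thesis
    using LIMSEQ_unique by blast
qed

lemma qpoch_inf_square:
  assumes "norm q < 1"
  shows "qpoch_inf (a\<^sup>2) (q\<^sup>2) = qpoch_inf a q * qpoch_inf (- a) q"
  by (rule qpoch_infI[OF norm_power2_less_1[OF assms]], unfold qpoch_square)
     (intro tendsto_intros qpoch_tendsto assms)

section \<open>Uniform bounds and infinite iteration of recurrences\<close>

lemma qpoch_bounded:
  assumes "norm q < 1"
  obtains C where "C > 0" "\<And>n. norm (qpoch a q n) \<le> C"
  using qpoch_tendsto[OF assms, of a] by (metis BseqE convergentI convergent_imp_Bseq)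

lemma inverse_qpoch_bounded:
  assumes "norm q < 1" "\<And>k. a * q ^ k \<noteq> 1"
  obtains C where "C > 0" "\<And>n. norm (inverse (qpoch a q n)) \<le> C"
proof -
  have "(\<lambda>n. inverse (qpoch a q n)) \<longlonglongrightarrow> inverse (qpoch_inf a q)"
    by (intro tendsto_intros qpoch_tendsto qpoch_inf_nonzero assms)
  thus ?thesis
    using that by (metis BseqE convergentI convergent_imp_Bseq)
qed

text \<open>Multiplying the recurrence by \<open>r ^ k\<close> makes it telescope, and boundedness
  of \<open>t\<close> sends the remainder \<open>r ^ k * t k\<close> to 0. Both
  \<open>heine_sum\<close> and \<open>fine_sum\<close> are obtained this way, with
  \<open>t k\<close> a series whose parameter is shifted \<open>k\<close> times.\<close>

lemma iterate_recurrence_sums: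
  fixes t :: "nat \<Rightarrow> complex"
  assumes "norm r < 1" "\<And>k. norm (t k) \<le> C" "\<And>k. t k - r * t (Suc k) = c k"
  shows "(\<lambda>k. r ^ k * c k) sums t 0"
proof -
  have "(\<lambda>k. r ^ k * t k) \<longlonglongrightarrow> 0"
  proof (rule Lim_null_comparison)
    show "\<forall>\<^sub>F k in sequentially. norm (r ^ k * t k) \<le> norm r ^ k * C"
      by (simp add: norm_mult norm_power assms(2) mult_left_mono)
    show "(\<lambda>k. norm r ^ k * C) \<longlonglongrightarrow> 0"
      using assms(1) by (intro tendsto_mult_left_zero LIMSEQ_power_zero) simp
  qed
  from telescope_sums'[OF this] show ?thesis
    by (simp add: assms(3)[symmetric] algebra_simps)
qed

text \<open>The explicit bound serves as much as summability: when \<open>C\<close> is independent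
  of a parameter, it gives the uniform bound on the iterates that
  \<open>iterate_recurrence_sums\<close> requires.\<close>

lemma summable_geometric_bound:
  fixes f :: "nat \<Rightarrow> complex"
  assumes "norm r < 1" "\<And>n. norm (f n) \<le> C * norm r ^ n"
  shows "summable f" "norm (suminf f) \<le> C / (1 - norm r)"
proof -
  have s: "(\<lambda>n. C * norm r ^ n) sums (C * (1 / (1 - norm r)))"
    using assms(1) by (intro sums_mult geometric_sums) simp
  have n: "summable (\<lambda>n. norm (f n))"
    by (rule summable_comparison_test'[OF sums_summable[OF s], of 0]) (simp add: assms(2))
  thus "summable f"
    by (rule summable_norm_cancel)
  have "norm (suminf f) \<le> (\<Sum>n. norm (f n))"
    by (rule summable_norm[OF n])
  also have "\<dots> \<le> C * (1 / (1 - norm r))"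
    using suminf_le[OF assms(2) n sums_summable[OF s]] sums_unique[OF s] by simp
  finally show "norm (suminf f) \<le> C / (1 - norm r)"
    by simp
qed

subsection \<open>Series transformations\<close>

text \<open>The shifted symbol is the quotient of \<open>qpoch b q (k + n)\<close> by
  \<open>qpoch b q k\<close>, so a bound on the symbols and one on their inverses suffice for all
  shifts at once.\<close>

lemma inverse_qpoch_shift_bounded:
  assumes "norm q < 1" "\<And>k. b * q ^ k \<noteq> 1"
  obtains C where "C > 0" "\<And>k n. norm (inverse (qpoch (b * q ^ k) q n)) \<le> C"
proof -
  obtain C1 where C1: "C1 > 0" "\<And>n. norm (qpoch b q n) \<le> C1"
    using qpoch_bounded[OF assms(1)] by blast
  obtain C2 where C2: "C2 > 0" "\<And>n. norm (inverse (qpoch b q n)) \<le> C2"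
    using inverse_qpoch_bounded[OF assms] by blast
  have "norm (inverse (qpoch (b * q ^ k) q n)) \<le> C1 * C2" for k n
  proof -
    have "inverse (qpoch (b * q ^ k) q n) = qpoch b q k * inverse (qpoch b q (k + n))"
      using qpoch_nonzero[OF assms(2), of k] by (simp add: qpoch_add)
    thus ?thesis
      using C1(2)[of k] C2(2)[of "k + n"] C1(1) by (simp only: norm_mult) (intro mult_mono; simp)
  qed
  with C1(1) C2(1) that[of "C1 * C2"] show ?thesis by simp
qed

text \<open>This is the summand of \<open>heine_sum\<close> divided by \<open>1 - b\<close>. The
  normalisation makes the coefficient in the recurrence under \<open>b\<close> to
  \<open>b * q\<close> the constant \<open>q / a\<close>, free of \<open>b\<close>.\<close>

definition heine_term :: "complex \<Rightarrow> complex \<Rightarrow> complex \<Rightarrow> nat \<Rightarrow> complex" where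
  "heine_term a b q n = qpoch q q n * q ^ n / (qpoch (a * q) q n * qpoch b q (Suc n))"

text \<open>The summand is a difference of consecutive values of the certificate \<open>G\<close>.
  Of the two terms on the right, the rational one is \<open>- G 0\<close> and the infinite product
  is the limit of \<open>G\<close>.\<close>

lemma heine_term_recurrence:
  assumes q: "norm q < 1" and a: "a \<noteq> 0" and aq: "\<And>k. a * q * q ^ k \<noteq> 1"
    and b: "\<And>k. b * q ^ k \<noteq> 1"
  shows "(\<lambda>n. heine_term a b q n - q / a * heine_term a (b * q) q n) sums
    ((1 - 1 / a) / (1 - b) + 1 / a * qpoch_inf q q / (qpoch_inf (a * q) q * qpoch_inf b q))"
proof -
  \<comment> \<open>\<open>G n\<close> is \<open>qpoch q q n / (a * (qpoch (a * q) q (n - 1) * qpoch b q (Suc n)))\<close>, written so that no index \<open>- 1\<close> occurs at \<open>n = 0\<close>.\<close>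
  define G where "G n = 1 / a * qpoch q q n * (1 - a * q ^ n) / (qpoch (a * q) q n * qpoch b q (Suc n))" for n
  have "heine_term a b q n - q / a * heine_term a (b * q) q n = G (Suc n) - G n" for n
  proof -
    define X Y Z where "X = qpoch q q n" and "Y = qpoch (a * q) q n" and "Z = qpoch b q (Suc n)"
    have nz: "Y \<noteq> 0" "Z \<noteq> 0" "1 - b \<noteq> 0" "1 - a * q * q ^ n \<noteq> 0" "1 - b * q ^ Suc n \<noteq> 0"
      using qpoch_nonzero[OF aq, of n] qpoch_nonzero[OF b, of "Suc n"] b[of 0] aq[of n] b[of "Suc n"]
      unfolding Y_def Z_def by auto
    define D1 D2 where "D1 = 1 - a * q * q ^ n" and "D2 = 1 - b * q ^ Suc n"
    \<comment> \<open>Dividing by this common factor turns all four terms into polynomials in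
      \<open>q ^ n\<close>, so that the certificate reduces to the polynomial identity 5.\<close>
    define K where "K = X / (a * Y * Z * D2)"
    have nz': "D1 \<noteq> 0" "D2 \<noteq> 0"
      using nz by (simp_all add: D1_def D2_def)
    have 1: "qpoch (b * q) q (Suc n) = Z * D2 / (1 - b)"
      using qpoch_Suc_left[of b q "Suc n"] nz
      unfolding Z_def D2_def qpoch_Suc[of b q "Suc n"] by (simp add: field_simps)
    have "G (Suc n) = 1 / a * (X * (1 - q * q ^ n)) * D1 / ((Y * D1) * (Z * D2))"
      unfolding G_def X_def Y_def Z_def D1_def D2_def qpoch_Suc[of _ _ "Suc n"] qpoch_Suc[of q q n]
        qpoch_Suc[of "a*q" q n] by (simp add: mult.assoc)
    hence 2: "G (Suc n) = K * (1 - q * q ^ n)"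
      using nz' by (simp add: K_def)
    have "heine_term a b q n = X * q ^ n / (Y * Z)" "G n = 1 / a * X * (1 - a * q ^ n) / (Y * Z)"
      by (simp_all add: heine_term_def G_def X_def Y_def Z_def)
    hence 3: "heine_term a b q n = K * (a * q ^ n * D2)" "G n = K * ((1 - a * q ^ n) * D2)"
      using a nz' by (simp_all add: K_def)
    have "heine_term a (b * q) q n = X * q ^ n * (1 - b) / (Y * (Z * D2))"
      unfolding heine_term_def 1 using nz by (simp add: X_def Y_def)
    hence 4: "q / a * heine_term a (b * q) q n = K * (q * q ^ n * (1 - b))"
      by (simp add: K_def mult.assoc mult.left_commute)
    have 5: "a * q ^ n * D2 - q * q ^ n * (1 - b) = (1 - q * q ^ n) - (1 - a * q ^ n) * D2"
      by (simp add: D2_def algebra_simps)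
    show ?thesis
      unfolding 2 3 4 using arg_cong[OF 5, of "(*) K"] by (simp only: right_diff_distrib)
  qed
  moreover have "(\<lambda>n. G (Suc n) - G n) sums
    (1 / a * qpoch_inf q q * (1 - a * 0) / (qpoch_inf (a * q) q * qpoch_inf b q) - G 0)"
    unfolding G_def
    by (intro telescope_sums tendsto_intros qpoch_tendsto q LIMSEQ_power_zero
        filterlim_compose[OF qpoch_tendsto filterlim_Suc]
        no_zero_divisors qpoch_inf_nonzero aq b)
  moreover have "G 0 = - ((1 - 1 / a) / (1 - b))"
    using a b[of 0] by (simp add: G_def qpoch_Suc divide_simps)
  ultimately show ?thesis
    by (simp add: add.commute)
qed

lemma heine_term_bounded:
  assumes q: "norm q < 1" and aq: "\<And>k. a * q * q ^ k \<noteq> 1" and b: "\<And>k. b * q ^ k \<noteq> 1"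
  obtains C where "C > 0" "\<And>k n. norm (heine_term a (b * q ^ k) q n) \<le> C * norm q ^ n"
proof -
  obtain C1 where C1: "C1 > 0" "\<And>n. norm (qpoch q q n) \<le> C1"
    using qpoch_bounded[OF q] by blast
  obtain C2 where C2: "C2 > 0" "\<And>n. norm (inverse (qpoch (a * q) q n)) \<le> C2"
    using inverse_qpoch_bounded[OF q aq] by blast
  obtain C3 where C3: "C3 > 0" "\<And>k n. norm (inverse (qpoch (b * q ^ k) q n)) \<le> C3"
    using inverse_qpoch_shift_bounded[OF q b] by blast
  have "norm (heine_term a (b * q ^ k) q n) \<le> (C1 * C2 * C3) * norm q ^ n" for k n
  proof -
    have "heine_term a (b * q ^ k) q n = (qpoch q q n * inverse (qpoch (a * q) q n) *
        inverse (qpoch (b * q ^ k) q (Suc n))) * q ^ n"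
      unfolding heine_term_def by (simp only: divide_inverse inverse_mult_distrib ac_simps)
    thus ?thesis
      using C1 C2 C3 by (simp only: norm_mult norm_power) (intro mult_mono mult_nonneg_nonneg; simp)
  qed
  with C1(1) C2(1) C3(1) that[of "C1 * C2 * C3"] show ?thesis by simp
qed

lemma heine_sum:
  assumes q: "norm q < 1" and r: "norm (q / a) < 1" and a: "a \<noteq> 0"
    and aq: "\<And>k. a * q * q ^ k \<noteq> 1" and b: "\<And>k. b * q ^ k \<noteq> 1"
  shows "(\<lambda>n. qpoch q q n * q ^ n / (qpoch (a * q) q n * qpoch (b * q) q n)) sums
    ((1 - b) * (1 - 1 / a) * (\<Sum>k. (q / a) ^ k / (1 - b * q ^ k)) +
     1 / a * qpoch_inf q q / (qpoch_inf (a * q) q * qpoch_inf (b * q) q) * (\<Sum>k. (q / a) ^ k * qpoch b q k))"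
proof -
  obtain C where C: "C > 0" "\<And>k n. norm (heine_term a (b * q ^ k) q n) \<le> C * norm q ^ n"
    using heine_term_bounded[OF q aq b] by blast
  define t where "t k = suminf (heine_term a (b * q ^ k) q)" for k
  have sm: "summable (heine_term a (b * q ^ k) q)" for k
    by (rule summable_geometric_bound(1)[OF q C(2)])
  have t_bound: "norm (t k) \<le> C / (1 - norm q)" for k
    unfolding t_def by (rule summable_geometric_bound(2)[OF q C(2)])
  define c where "c k = (1 - 1 / a) / (1 - b * q ^ k) +
    1 / a * qpoch_inf q q / (qpoch_inf (a * q) q * qpoch_inf (b * q ^ k) q)" for k
  have rec: "t k - q / a * t (Suc k) = c k" for k
  proof -
    have bk: "b * q ^ k * q ^ j \<noteq> 1" for j
      using b[of "k + j"] by (simp add: power_add mult.assoc)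
    have "(\<lambda>n. heine_term a (b * q ^ k) q n - q / a * heine_term a (b * q ^ k * q) q n) sums
        (t k - q / a * t (Suc k))"
      unfolding t_def using sm[of k] sm[of "Suc k"]
      by (intro sums_diff sums_mult summable_sums) (simp_all add: mult.assoc mult.commute[of q] summable_sums)
    from sums_unique2[OF this heine_term_recurrence[OF q a aq bk]] show ?thesis
      by (simp add: c_def)
  qed
  have c_sums: "(\<lambda>k. (q / a) ^ k * c k) sums t 0"
    by (rule iterate_recurrence_sums[where t = t and c = c, OF r t_bound rec])
  obtain C1 where C1: "C1 > 0" "\<And>k n. norm (inverse (qpoch (b * q ^ k) q n)) \<le> C1"
    using inverse_qpoch_shift_bounded[OF q b] by blast
  obtain C2 where C2: "C2 > 0" "\<And>n. norm (qpoch b q n) \<le> C2"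
    using qpoch_bounded[OF q] by blast
  have s1: "summable (\<lambda>k. (q / a) ^ k / (1 - b * q ^ k))"
  proof (rule summable_geometric_bound(1)[OF r, of _ C1])
    show "norm ((q / a) ^ n / (1 - b * q ^ n)) \<le> C1 * norm (q / a) ^ n" for n
      using mult_right_mono[OF C1(2)[of n "Suc 0"], of "norm (q / a) ^ n"]
      by (simp add: qpoch_Suc norm_mult norm_power norm_divide divide_inverse norm_inverse ac_simps)
  qed
  have s2: "summable (\<lambda>k. (q / a) ^ k * qpoch b q k)"
  proof (rule summable_geometric_bound(1)[OF r, of _ C2])
    show "norm ((q / a) ^ n * qpoch b q n) \<le> C2 * norm (q / a) ^ n" for n
      using mult_right_mono[OF C2(2)[of n], of "norm (q / a) ^ n"]
      by (simp add: norm_mult norm_power norm_divide ac_simps)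
  qed
  have nz: "qpoch_inf b q \<noteq> 0" "1 - b \<noteq> 0"
    using qpoch_inf_nonzero[OF q b] b[of 0] by auto
  have bb: "qpoch_inf b q = (1 - b) * qpoch_inf (b * q) q"
    using qpoch_inf_split[OF q, of b 1] by (simp add: qpoch_Suc)
  have c_eq: "(q / a) ^ k * c k = (1 - 1 / a) * ((q / a) ^ k / (1 - b * q ^ k)) +
      1 / a * qpoch_inf q q / (qpoch_inf (a * q) q * qpoch_inf b q) * ((q / a) ^ k * qpoch b q k)" for k
  proof -
    \<comment> \<open>The finite symbols \<open>qpoch b q k\<close> of the second series arise here:
      the product at the shifted parameter lacks the first \<open>k\<close> factors.\<close>
    have "qpoch_inf (b * q ^ k) q = qpoch_inf b q / qpoch b q k"
      using qpoch_inf_split[OF q, of b k] qpoch_nonzero[OF b, of k] by simp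
    thus ?thesis
      by (simp add: c_def distrib_left mult.commute mult.left_commute)
  qed
  have "(\<lambda>k. (q / a) ^ k * c k) sums ((1 - 1 / a) * (\<Sum>k. (q / a) ^ k / (1 - b * q ^ k)) +
      1 / a * qpoch_inf q q / (qpoch_inf (a * q) q * qpoch_inf b q) * (\<Sum>k. (q / a) ^ k * qpoch b q k))"
    unfolding c_eq by (intro sums_add sums_mult summable_sums s1 s2)
  hence t0: "t 0 = (1 - 1 / a) * (\<Sum>k. (q / a) ^ k / (1 - b * q ^ k)) +
      1 / a * qpoch_inf q q / (qpoch_inf (a * q) q * qpoch_inf b q) * (\<Sum>k. (q / a) ^ k * qpoch b q k)"
    using c_sums sums_unique2 by blast
  have "(\<lambda>n. (1 - b) * heine_term a b q n) sums ((1 - b) * t 0)"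
    unfolding t_def using sm[of 0] by (intro sums_mult) (simp add: summable_sums)
  also have "(\<lambda>n. (1 - b) * heine_term a b q n) =
      (\<lambda>n. qpoch q q n * q ^ n / (qpoch (a * q) q n * qpoch (b * q) q n))"
    unfolding heine_term_def qpoch_Suc_left using nz by auto
  also have "(1 - b) * t 0 = (1 - b) * (1 - 1 / a) * (\<Sum>k. (q / a) ^ k / (1 - b * q ^ k)) +
     1 / a * qpoch_inf q q / (qpoch_inf (a * q) q * qpoch_inf (b * q) q) * (\<Sum>k. (q / a) ^ k * qpoch b q k)"
    unfolding t0 bb using nz by (simp add: distrib_left mult.assoc)
  finally show "(\<lambda>n. qpoch q q n * q ^ n / (qpoch (a * q) q n * qpoch (b * q) q n)) sums \<dots>" .
qed

section \<open>Theta-like expansions: the transformation of Fine type and Euler's series\<close>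

lemma Suc_choose_2: "Suc n choose 2 = n + (n choose 2)"
  by (simp add: numeral_2_eq_2)

lemma twice_choose_2: "2 * (n choose 2) + n = n\<^sup>2"
  by (induction n) (simp_all add: Suc_choose_2 power2_eq_square)

text \<open>Consecutive terms have ratio \<open>norm q ^ n * norm x\<close>, which tends to 0
  whatever the size of \<open>x\<close>.\<close>

lemma summable_theta_like:
  fixes q x :: complex
  assumes "norm q < 1"
  shows "summable (\<lambda>n. norm (q ^ (n choose 2) * x ^ n))"
proof -
  have "(\<lambda>n. norm q ^ n * norm x) \<longlonglongrightarrow> 0"
    using assms by (intro tendsto_mult_left_zero LIMSEQ_power_zero) simp
  hence "\<forall>\<^sub>F n in sequentially. norm q ^ n * norm x < 1 / 2"
    by (rule order_tendstoD) simp
  then obtain N where N: "\<And>n. n \<ge> N \<Longrightarrow> norm q ^ n * norm x < 1 / 2"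
    unfolding eventually_sequentially by blast
  show ?thesis
  proof (rule summable_ratio_test[where c = "1 / 2" and N = N])
    fix n assume "n \<ge> N"
    have "norm (norm (q ^ (Suc n choose 2) * x ^ Suc n)) =
        (norm q ^ n * norm x) * norm (norm (q ^ (n choose 2) * x ^ n))"
      by (simp add: Suc_choose_2 norm_mult norm_power power_add)
    also have "\<dots> \<le> 1 / 2 * norm (norm (q ^ (n choose 2) * x ^ n))"
      using N[OF \<open>n \<ge> N\<close>] by (intro mult_right_mono) auto
    finally show "norm (norm (q ^ (Suc n choose 2) * x ^ Suc n)) \<le>
        1 / 2 * norm (norm (q ^ (n choose 2) * x ^ n))" .
  qed simp
qed

text \<open>Regarded as functions of \<open>b\<close>, both sides satisfy
  \<open>F x = 1 + r * (1 - x) * F (x * q)\<close>. For the series on the right this is a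
  telescoping identity, and iterating it along \<open>b * q ^ k\<close> generates the series on the
  left.\<close>

lemma fine_sum:
  assumes q: "norm q < 1" and r: "norm r < 1"
  shows "(\<lambda>k. r ^ k * qpoch b q k) sums
    (\<Sum>m. (-1) ^ m * q ^ (m choose 2) * (b * r) ^ m / qpoch r q (Suc m))"
    and "summable (\<lambda>m. (-1) ^ m * q ^ (m choose 2) * (b * r) ^ m / qpoch r q (Suc m))"
proof -
  have rq: "r * q ^ k \<noteq> 1" for k
    by (rule qpower_neq_1[OF q r])
  \<comment> \<open>The telescoping certificate for \<open>M\<close>: the defect of the functional
    equation at index \<open>m\<close> is \<open>w x m - w x (Suc m)\<close>, and
    \<open>w x 0\<close> is the inhomogeneous term 1.\<close>
  define w where "w x m = (-1) ^ m * q ^ (m choose 2) * (x * r) ^ m / qpoch r q m" for x m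
  define M where "M x m = (-1) ^ m * q ^ (m choose 2) * (x * r) ^ m / qpoch r q (Suc m)" for x m
  obtain C where C: "C > 0" "\<And>n. norm (inverse (qpoch r q n)) \<le> C"
    using inverse_qpoch_bounded[OF q rq] by blast
  \<comment> \<open>Allowing every \<open>x\<close> with \<open>norm x \<le> norm b\<close> covers
    all shifts \<open>b * q ^ k\<close> by one majorant; the separate index \<open>n\<close> serves
    both \<open>w\<close> (\<open>n = m\<close>) and \<open>M\<close>
    (\<open>n = Suc m\<close>).\<close>
  have bound: "norm ((-1) ^ m * q ^ (m choose 2) * (x * r) ^ m / qpoch r q n) \<le>
      C * norm (q ^ (m choose 2) * (b * r) ^ m)" if "norm x \<le> norm b" for x m n
  proof -
    have "norm ((-1) ^ m * q ^ (m choose 2) * (x * r) ^ m / qpoch r q n) =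
        norm (inverse (qpoch r q n)) * (norm q ^ (m choose 2) * (norm x * norm r) ^ m)"
      by (simp add: norm_mult norm_power norm_divide norm_inverse divide_inverse)
    also have "\<dots> \<le> C * (norm q ^ (m choose 2) * (norm b * norm r) ^ m)"
      using that C by (intro mult_mono power_mono) auto
    finally show ?thesis
      by (simp add: norm_mult norm_power)
  qed
  have sB: "summable (\<lambda>m. C * norm (q ^ (m choose 2) * (b * r) ^ m))"
    by (intro summable_mult summable_theta_like q)
  have sM_norm: "summable (\<lambda>m. norm (M x m))" and sw: "summable (w x)" if "norm x \<le> norm b" for x
  proof -
    show "summable (\<lambda>m. norm (M x m))"
      unfolding M_def by (rule summable_comparison_test'[OF sB, of 0]) (use bound[OF that] in simp)
    show "summable (w x)"
      unfolding w_def by (rule summable_comparison_test'[OF sB, of 0]) (use bound[OF that] in simp)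
  qed
  hence sM: "summable (M x)" if "norm x \<le> norm b" for x
    using that by (blast intro: summable_norm_cancel)
  have M_bound: "norm (suminf (M x)) \<le> (\<Sum>m. C * norm (q ^ (m choose 2) * (b * r) ^ m))"
    if "norm x \<le> norm b" for x
    by (rule order.trans[OF summable_norm[OF sM_norm[OF that]] suminf_le[OF _ sM_norm[OF that] sB]])
       (use bound[OF that] in \<open>simp add: M_def\<close>)
  have nb: "norm (b * q ^ k) \<le> norm b" for k
    unfolding norm_mult norm_power using q by (intro mult_left_le power_le_one) auto
  have M_rec: "suminf (M x) - r * (1 - x) * suminf (M (x * q)) = 1"
    if x: "norm x \<le> norm b" "norm (x * q) \<le> norm b" for x
  proof -
    have step: "M x m - r * (1 - x) * M (x * q) m = w x m - w x (Suc m)" for m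
    proof -
      have nz: "qpoch r q m \<noteq> 0" "1 - r * q ^ m \<noteq> 0"
        using qpoch_nonzero[OF rq, of m] rq[of m] by auto
      define P where "P = (-1) ^ m * q ^ (m choose 2) * (x * r) ^ m / (qpoch r q m * (1 - r * q ^ m))"
      have 1: "M x m = P" "w x m = P * (1 - r * q ^ m)"
        using nz by (simp_all add: M_def P_def w_def qpoch_Suc)
      have 2: "M (x * q) m = P * q ^ m" "w x (Suc m) = - x * r * q ^ m * P"
        by (simp_all add: M_def P_def w_def qpoch_Suc power_mult_distrib Suc_choose_2 power_add)
      show ?thesis
        unfolding 1 2 by (simp add: algebra_simps)
    qed
    have "(\<lambda>m. w x m - w x (Suc m)) sums (w x 0 - 0)"
      by (intro telescope_sums' summable_LIMSEQ_zero sw x)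
    moreover have "(\<lambda>m. M x m - r * (1 - x) * M (x * q) m) sums
        (suminf (M x) - r * (1 - x) * suminf (M (x * q)))"
      by (intro sums_diff sums_mult summable_sums sM x)
    ultimately have "suminf (M x) - r * (1 - x) * suminf (M (x * q)) = w x 0 - 0"
      unfolding step using sums_unique2 by blast
    thus ?thesis
      by (simp add: w_def numeral_2_eq_2)
  qed
  obtain D where D: "D > 0" "\<And>n. norm (qpoch b q n) \<le> D"
    using qpoch_bounded[OF q] by blast
  have "(\<lambda>k. r ^ k * qpoch b q k) sums (qpoch b q 0 * suminf (M (b * q ^ 0)))"
  \<comment> \<open>The weight \<open>qpoch b q k\<close> absorbs the factor
    \<open>1 - b * q ^ k\<close> of the functional equation, which leaves the constant multiplier
    \<open>r\<close>.\<close>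
  proof (rule iterate_recurrence_sums[where t = "\<lambda>k. qpoch b q k * suminf (M (b * q ^ k))", OF r])
    show "norm (qpoch b q k * suminf (M (b * q ^ k))) \<le>
        D * (\<Sum>m. C * norm (q ^ (m choose 2) * (b * r) ^ m))" for k
      unfolding norm_mult using D M_bound[OF nb, of k] by (intro mult_mono) (auto simp: norm_mult)
    show "qpoch b q k * suminf (M (b * q ^ k)) -
        r * (qpoch b q (Suc k) * suminf (M (b * q ^ Suc k))) = qpoch b q k" for k
      using arg_cong[OF M_rec[of "b * q ^ k"], of "\<lambda>z. qpoch b q k * z"] nb[of k] nb[of "Suc k"]
      by (simp add: qpoch_Suc algebra_simps)
  qed
  thus "(\<lambda>k. r ^ k * qpoch b q k) sums
    (\<Sum>m. (-1) ^ m * q ^ (m choose 2) * (b * r) ^ m / qpoch r q (Suc m))"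
    by (simp add: M_def[abs_def])
  show "summable (\<lambda>m. (-1) ^ m * q ^ (m choose 2) * (b * r) ^ m / qpoch r q (Suc m))"
    using sM[of b] by (simp add: M_def[abs_def])
qed

text \<open>The partial products telescope with differences \<open>b * q ^ k * qpoch b q k\<close>.
  \<open>fine_sum\<close> at \<open>r = q\<close> evaluates their sum, and the outcome is Euler's
  series without its initial term 1.\<close>

lemma euler_qpoch_inf_sums:
  assumes q: "norm q < 1"
  shows "(\<lambda>m. (-1) ^ m * q ^ (m choose 2) * b ^ m / qpoch q q m) sums qpoch_inf b q"
proof -
  define e where "e m = (-1) ^ m * q ^ (m choose 2) * b ^ m / qpoch q q m" for m
  have "(\<lambda>k. b * (q ^ k * qpoch b q k)) sums
      (b * (\<Sum>m. (-1) ^ m * q ^ (m choose 2) * (b * q) ^ m / qpoch q q (Suc m)))"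
    by (intro sums_mult fine_sum q)
  moreover have "(\<lambda>k. qpoch b q k - qpoch b q (Suc k)) sums (qpoch b q 0 - qpoch_inf b q)"
    by (intro telescope_sums' qpoch_tendsto q)
  moreover have step: "b * (q ^ k * qpoch b q k) = qpoch b q k - qpoch b q (Suc k)" for k
    by (simp add: qpoch_Suc algebra_simps)
  ultimately have "b * (\<Sum>m. (-1) ^ m * q ^ (m choose 2) * (b * q) ^ m / qpoch q q (Suc m)) =
      qpoch b q 0 - qpoch_inf b q"
    unfolding step using sums_unique2 by blast
  hence *: "b * (\<Sum>m. (-1) ^ m * q ^ (m choose 2) * (b * q) ^ m / qpoch q q (Suc m)) =
      1 - qpoch_inf b q"
    by simp
  have "(\<lambda>m. - b * ((-1) ^ m * q ^ (m choose 2) * (b * q) ^ m / qpoch q q (Suc m))) sums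
      (- b * (\<Sum>m. (-1) ^ m * q ^ (m choose 2) * (b * q) ^ m / qpoch q q (Suc m)))"
    by (intro sums_mult summable_sums fine_sum(2) q)
  also have "(\<lambda>m. - b * ((-1) ^ m * q ^ (m choose 2) * (b * q) ^ m / qpoch q q (Suc m))) =
      (\<lambda>m. e (Suc m))"
    by (auto simp: e_def Suc_choose_2 power_add power_mult_distrib)
  finally have "(\<lambda>m. e (Suc m)) sums (qpoch_inf b q - 1)"
    using * by simp
  hence "e sums (qpoch_inf b q - 1 + e 0)"
    by (simp add: sums_Suc_iff)
  moreover have "e 0 = 1"
    by (simp add: e_def numeral_2_eq_2)
  ultimately show ?thesis
    unfolding e_def by simp
qed

subsection \<open>A bilateral theta-type series\<close>

text \<open>The two halves of the bilateral series \<open>\<Sum>n\<in>\<int>. (-1)^n q^(n\<^sup>2) / (x; q\<^sup>2)\<^sub>n\<close>, where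
  \<open>1 / (x; q\<^sup>2)\<^sub>-\<^sub>n = (x q^(-2n); q\<^sup>2)\<^sub>n\<close>. At \<open>x = - q\<^sup>2\<close> the first half is
  \<open>\<phi>\<^sub>3(-q)\<close>; at \<open>x = q\<^sup>2\<close> the second half vanishes and the first is an Euler product.\<close>

definition bilateral_pos :: "complex \<Rightarrow> complex \<Rightarrow> nat \<Rightarrow> complex" where
  "bilateral_pos q x n = (-1) ^ n * q ^ (n\<^sup>2) / qpoch x (q\<^sup>2) n"

definition bilateral_neg :: "complex \<Rightarrow> complex \<Rightarrow> nat \<Rightarrow> complex" where
  "bilateral_neg q x n = (- 1 / q) ^ n * (\<Prod>j<n. (q\<^sup>2) ^ Suc j - x)"

definition bilateral :: "complex \<Rightarrow> complex \<Rightarrow> complex" where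
  "bilateral q x = (\<Sum>n. bilateral_pos q x n) + (\<Sum>n. bilateral_neg q x (Suc n))"

lemma suminf_dominated_tendsto:
  fixes a :: "nat \<Rightarrow> nat \<Rightarrow> complex"
  assumes "\<And>n. (\<lambda>N. a N n) \<longlonglongrightarrow> b n" "\<And>N n. norm (a N n) \<le> M n" "summable M"
  shows "(\<lambda>N. suminf (a N)) \<longlonglongrightarrow> suminf b"
  using tannerys_theorem[where a = "\<lambda>n N. a N n" and F = sequentially and M = M and b = b,
      OF assms(1) always_eventually assms(3)] assms(2) by simp

lemma power_square_eq: "(q :: complex) ^ (n\<^sup>2) = (q\<^sup>2) ^ (n choose 2) * q ^ n"
  by (simp add: power_mult [symmetric] power_add [symmetric] twice_choose_2)

section \<open>Convergence of the bilateral series, uniformly under shifts of x\<close>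

context
  fixes q x :: complex
  assumes q: "q \<noteq> 0" "norm q < 1" and x: "norm x < norm q"
begin

lemma square_less_1: "norm (q\<^sup>2) < 1"
  using norm_power2_less_1[OF q(2)] .

lemma x_nonpole: "x * (q\<^sup>2) ^ k \<noteq> 1"
  using qpower_neq_1[OF square_less_1, of x] x q by auto

lemma bilateral_pos_bound:
  obtains C where "\<And>N n. norm (bilateral_pos q (x * (q\<^sup>2) ^ N) n) \<le> C * norm ((q\<^sup>2) ^ (n choose 2) * q ^ n)"
proof -
  obtain C where C: "C > 0" "\<And>N n. norm (inverse (qpoch (x * (q\<^sup>2) ^ N) (q\<^sup>2) n)) \<le> C"
    using inverse_qpoch_shift_bounded[OF square_less_1 x_nonpole] by blast
  have "norm (bilateral_pos q (x * (q\<^sup>2) ^ N) n) \<le> C * norm ((q\<^sup>2) ^ (n choose 2) * q ^ n)" for N n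
  proof -
    have "norm (bilateral_pos q (x * (q\<^sup>2) ^ N) n) =
        norm (inverse (qpoch (x * (q\<^sup>2) ^ N) (q\<^sup>2) n)) * norm ((q\<^sup>2) ^ (n choose 2) * q ^ n)"
      by (simp add: bilateral_pos_def power_square_eq norm_mult norm_divide norm_power norm_inverse
          divide_inverse)
    also have "\<dots> \<le> C * norm ((q\<^sup>2) ^ (n choose 2) * q ^ n)"
      by (intro mult_right_mono C) simp
    finally show ?thesis .
  qed
  thus ?thesis using that by blast
qed

text \<open>By the triangle inequality this dominates the negative half for all parameters of norm
  at most \<open>norm x\<close>, hence for all shifts \<open>x * (q^2)^N\<close>
  simultaneously.\<close>

definition neg_majorant :: "nat \<Rightarrow> real" where
  "neg_majorant n = (1 / norm q) ^ n * (\<Prod>j<n. norm (q\<^sup>2) ^ Suc j + norm x)"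

text \<open>Ratio test: the ratios tend to \<open>norm x / norm q\<close>, which is below 1 by the
  assumption on \<open>x\<close>. The constant \<open>c\<close> is the midpoint between this limit
  and 1.\<close>

lemma summable_neg_majorant: "summable neg_majorant"
proof -
  define c where "c = (norm x / norm q + 1) / 2"
  have c: "norm x / norm q < c" "c < 1"
    using x q by (simp_all add: c_def field_simps)
  have "(\<lambda>n. (norm (q\<^sup>2) ^ Suc n + norm x) / norm q) \<longlonglongrightarrow> (0 + norm x) / norm q"
    using q square_less_1
    by (intro tendsto_intros filterlim_compose[OF LIMSEQ_power_zero filterlim_Suc]) auto
  hence "\<forall>\<^sub>F n in sequentially. (norm (q\<^sup>2) ^ Suc n + norm x) / norm q < c"
    by (rule order_tendstoD) (use c in simp)
  then obtain N where N: "\<And>n. n \<ge> N \<Longrightarrow> (norm (q\<^sup>2) ^ Suc n + norm x) / norm q < c"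
    unfolding eventually_sequentially by blast
  have nonneg: "neg_majorant n \<ge> 0" for n
    by (auto simp: neg_majorant_def intro!: mult_nonneg_nonneg prod_nonneg add_nonneg_nonneg)
  show ?thesis
  proof (rule summable_ratio_test[OF c(2)])
    fix n assume "n \<ge> N"
    have "neg_majorant (Suc n) = ((norm (q\<^sup>2) ^ Suc n + norm x) / norm q) * neg_majorant n"
      by (simp add: neg_majorant_def)
    hence "norm (neg_majorant (Suc n)) = ((norm (q\<^sup>2) ^ Suc n + norm x) / norm q) * norm (neg_majorant n)"
      using nonneg[of n] nonneg[of "Suc n"] by simp
    also have "\<dots> \<le> c * norm (neg_majorant n)"
      using N[OF \<open>n \<ge> N\<close>] by (intro mult_right_mono) auto
    finally show "norm (neg_majorant (Suc n)) \<le> c * norm (neg_majorant n)" .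
  qed
qed

lemma bilateral_neg_bound:
  assumes "norm y \<le> norm x"
  shows "norm (bilateral_neg q y n) \<le> neg_majorant n"
  unfolding bilateral_neg_def neg_majorant_def norm_mult norm_power prod_norm[symmetric] norm_divide norm_minus_cancel norm_one
proof (intro mult_left_mono prod_mono conjI)
  fix j
  show "norm ((q\<^sup>2) ^ Suc j - y) \<le> (norm q)\<^sup>2 ^ Suc j + norm x"
    using norm_triangle_ineq4[of "(q\<^sup>2) ^ Suc j" y] assms by (simp add: norm_mult norm_power)
qed auto

lemma norm_shift_le: "norm (x * (q\<^sup>2) ^ N) \<le> norm x"
  unfolding norm_mult norm_power using q by (intro mult_left_le power_le_one) auto

lemma summable_bilateral:
  shows "summable (bilateral_pos q (x * (q\<^sup>2) ^ N))"
    and "summable (\<lambda>n. bilateral_neg q (x * (q\<^sup>2) ^ N) (Suc n))"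
proof -
  obtain C where C: "\<And>N n. norm (bilateral_pos q (x * (q\<^sup>2) ^ N) n) \<le> C * norm ((q\<^sup>2) ^ (n choose 2) * q ^ n)"
    using bilateral_pos_bound by blast
  have "summable (\<lambda>n. C * norm ((q\<^sup>2) ^ (n choose 2) * q ^ n))"
    by (intro summable_mult summable_theta_like square_less_1)
  thus "summable (bilateral_pos q (x * (q\<^sup>2) ^ N))"
    by (rule summable_comparison_test'[where N = 0]) (rule C)
  have "summable (bilateral_neg q (x * (q\<^sup>2) ^ N))"
    by (rule summable_comparison_test'[OF summable_neg_majorant, where N = 0])
       (rule bilateral_neg_bound[OF norm_shift_le])
  thus "summable (\<lambda>n. bilateral_neg q (x * (q\<^sup>2) ^ N) (Suc n))"
    by (simp add: summable_Suc_iff)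
qed

text \<open>Dominated convergence, with majorants independent of \<open>N\<close> for both halves.
  The limit is the theta series of (-1)^n q^(n^2) over all integers n.\<close>

lemma bilateral_shift_tendsto:
  "(\<lambda>N. bilateral q (x * (q\<^sup>2) ^ N)) \<longlonglongrightarrow> bilateral q 0"
  unfolding bilateral_def
proof (rule tendsto_add)
  have lim: "(\<lambda>N. x * (q\<^sup>2) ^ N) \<longlonglongrightarrow> 0"
    using square_less_1 by (intro tendsto_mult_right_zero LIMSEQ_power_zero)
  obtain C where C: "\<And>N n. norm (bilateral_pos q (x * (q\<^sup>2) ^ N) n) \<le> C * norm ((q\<^sup>2) ^ (n choose 2) * q ^ n)"
    using bilateral_pos_bound by blast
  have "(\<lambda>N. bilateral_pos q (x * (q\<^sup>2) ^ N) n) \<longlonglongrightarrow> bilateral_pos q 0 n" for n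
    unfolding bilateral_pos_def qpoch_def
    by (intro tendsto_intros lim) auto
  moreover have "summable (\<lambda>n. C * norm ((q\<^sup>2) ^ (n choose 2) * q ^ n))"
    by (intro summable_mult summable_theta_like square_less_1)
  ultimately show "(\<lambda>N. suminf (bilateral_pos q (x * (q\<^sup>2) ^ N))) \<longlonglongrightarrow> suminf (bilateral_pos q 0)"
    using C by (intro suminf_dominated_tendsto)
  have "(\<lambda>N. bilateral_neg q (x * (q\<^sup>2) ^ N) n) \<longlonglongrightarrow> bilateral_neg q 0 n" for n
    unfolding bilateral_neg_def by (intro tendsto_intros lim)
  moreover have "summable (\<lambda>n. neg_majorant (Suc n))"
    using summable_neg_majorant by (simp add: summable_Suc_iff)
  ultimately show "(\<lambda>N. \<Sum>n. bilateral_neg q (x * (q\<^sup>2) ^ N) (Suc n)) \<longlonglongrightarrow> (\<Sum>n. bilateral_neg q 0 (Suc n))"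
    using bilateral_neg_bound[OF norm_shift_le] by (intro suminf_dominated_tendsto)
qed

end

text \<open>For each half separately the defect of the equation telescopes with the same constant
  \<open>k\<close>. The boundary terms at index 0 are \<open>k\<close> for the positive and
  \<open>- k\<close> for the negative half, so only the bilateral sum satisfies a homogeneous
  equation.\<close>

lemma bilateral_recurrence:
  assumes q: "q \<noteq> 0" "norm q < 1" and x: "norm x < norm q"
  shows "bilateral q (x * q\<^sup>2) = (1 - x) * (1 - x / q) * bilateral q x"
proof -
  have sm: "summable (bilateral_pos q x)" "summable (\<lambda>n. bilateral_neg q x (Suc n))"
    "summable (bilateral_pos q (x * q\<^sup>2))" "summable (\<lambda>n. bilateral_neg q (x * q\<^sup>2) (Suc n))"
    using summable_bilateral[OF q x, of 0] summable_bilateral[OF q x, of 1] by simp_all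
  have sm': "summable (bilateral_neg q x)"
    using sm(2) by (simp add: summable_Suc_iff)
  define k where "k = (1 - x) * (x / q)"
  have "bilateral_pos q (x * q\<^sup>2) n - (1 - x) * (1 - x / q) * bilateral_pos q x n =
      k * (bilateral_pos q x n - bilateral_pos q x (Suc n))" for n
  proof -
    define P where "P = (-1) ^ n * q ^ (n\<^sup>2) / qpoch x (q\<^sup>2) (Suc n)"
    have nz: "1 - x \<noteq> 0" "1 - x * (q\<^sup>2) ^ n \<noteq> 0"
      using x_nonpole[OF q x, of 0] x_nonpole[OF q x, of n] by auto
    have 1: "bilateral_pos q x n = P * (1 - x * (q\<^sup>2) ^ n)"
      using nz by (simp add: P_def bilateral_pos_def qpoch_Suc)
    have 2: "bilateral_pos q (x * q\<^sup>2) n = (1 - x) * P"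
      using nz by (simp add: P_def bilateral_pos_def qpoch_Suc_left)
    have "(Suc n)\<^sup>2 = n\<^sup>2 + 2 * n + 1"
      by (simp add: power2_eq_square)
    hence "q ^ (Suc n)\<^sup>2 = q ^ n\<^sup>2 * (q\<^sup>2) ^ n * q"
      by (simp only: power_add power_mult power_one_right)
    hence 3: "bilateral_pos q x (Suc n) = - P * (q\<^sup>2) ^ n * q"
      by (simp add: P_def bilateral_pos_def)
    show ?thesis
      unfolding 1 2 3 k_def using q by (simp add: field_simps)
  qed
  moreover have "(\<lambda>n. k * (bilateral_pos q x n - bilateral_pos q x (Suc n))) sums (k * (bilateral_pos q x 0 - 0))"
    by (intro sums_mult telescope_sums' summable_LIMSEQ_zero sm)
  moreover have "(\<lambda>n. bilateral_pos q (x * q\<^sup>2) n - (1 - x) * (1 - x / q) * bilateral_pos q x n) sums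
      (suminf (bilateral_pos q (x * q\<^sup>2)) - (1 - x) * (1 - x / q) * suminf (bilateral_pos q x))"
    by (intro sums_diff sums_mult summable_sums sm)
  ultimately have pos: "suminf (bilateral_pos q (x * q\<^sup>2)) - (1 - x) * (1 - x / q) * suminf (bilateral_pos q x) =
      k * (bilateral_pos q x 0 - 0)"
    using sums_unique2 by simp
  have "bilateral_neg q (x * q\<^sup>2) (Suc n) - (1 - x) * (1 - x / q) * bilateral_neg q x (Suc n) =
      k * (bilateral_neg q x (Suc n) - bilateral_neg q x n)" for n
  proof -
    define P where "P = bilateral_neg q x n"
    have 1: "bilateral_neg q x (Suc n) = P * (- 1 / q) * ((q\<^sup>2) ^ Suc n - x)"
      by (simp add: P_def bilateral_neg_def)
    \<comment> \<open>Pulling q^2 out of every factor lowers the index by one; the factor of index 0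
      becomes \<open>1 - x\<close> and the others form the product belonging to
      \<open>bilateral_neg q x n\<close>.\<close>
    have "(\<Prod>j<Suc n. (q\<^sup>2) ^ Suc j - x * q\<^sup>2) = (\<Prod>j<Suc n. q\<^sup>2 * ((q\<^sup>2) ^ j - x))"
      by (intro prod.cong) (simp_all add: algebra_simps)
    also have "\<dots> = (q\<^sup>2) ^ Suc n * ((1 - x) * (\<Prod>j<n. (q\<^sup>2) ^ Suc j - x))"
      by (simp add: prod.distrib prod.lessThan_Suc_shift del: power_Suc prod.lessThan_Suc)
    finally have 2: "bilateral_neg q (x * q\<^sup>2) (Suc n) = P * (- 1 / q) * (q\<^sup>2) ^ Suc n * (1 - x)"
      unfolding bilateral_neg_def P_def by simp
    show ?thesis
      unfolding 1 2 k_def P_def[symmetric] using q by (simp add: field_simps)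
  qed
  moreover have "(\<lambda>n. k * (bilateral_neg q x (Suc n) - bilateral_neg q x n)) sums (k * (0 - bilateral_neg q x 0))"
    by (intro sums_mult telescope_sums summable_LIMSEQ_zero sm')
  moreover have "(\<lambda>n. bilateral_neg q (x * q\<^sup>2) (Suc n) - (1 - x) * (1 - x / q) * bilateral_neg q x (Suc n)) sums
      ((\<Sum>n. bilateral_neg q (x * q\<^sup>2) (Suc n)) - (1 - x) * (1 - x / q) * (\<Sum>n. bilateral_neg q x (Suc n)))"
    by (intro sums_diff sums_mult summable_sums sm)
  ultimately have neg: "(\<Sum>n. bilateral_neg q (x * q\<^sup>2) (Suc n)) -
      (1 - x) * (1 - x / q) * (\<Sum>n. bilateral_neg q x (Suc n)) = k * (0 - bilateral_neg q x 0)"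
    using sums_unique2 by simp
  have "bilateral_pos q x 0 = 1" "bilateral_neg q x 0 = 1"
    by (simp_all add: bilateral_pos_def bilateral_neg_def)
  moreover have "P' + N' = c * (P + N)" if "P' - c * P = k * (1 - 0)" "N' - c * N = k * (0 - 1)"
    for P P' N N' c :: complex
    using that by (simp add: algebra_simps)
  ultimately show ?thesis
    using pos neg unfolding bilateral_def by metis
qed

text \<open>The recurrence is iterated \<open>N\<close> times and \<open>N\<close> tends to
  infinity. The right side is free of \<open>x\<close>, so different values of \<open>x\<close> can
  be compared.\<close>

lemma bilateral_product:
  assumes q: "q \<noteq> 0" "norm q < 1" and x: "norm x < norm q"
  shows "qpoch_inf x (q\<^sup>2) * qpoch_inf (x / q) (q\<^sup>2) * bilateral q x = bilateral q 0"
proof -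
  have "bilateral q (x * (q\<^sup>2) ^ N) = qpoch x (q\<^sup>2) N * qpoch (x / q) (q\<^sup>2) N * bilateral q x" for N
  proof (induction N)
    case (Suc N)
    have "norm (x * (q\<^sup>2) ^ N) < norm q"
      using norm_shift_le[OF q x, of N] x by simp
    from bilateral_recurrence[OF q this] Suc show ?case
      by (simp add: qpoch_Suc mult_ac)
  qed simp
  hence "(\<lambda>N. qpoch x (q\<^sup>2) N * qpoch (x / q) (q\<^sup>2) N * bilateral q x) \<longlonglongrightarrow> bilateral q 0"
    using bilateral_shift_tendsto[OF q x] by simp
  moreover have "(\<lambda>N. qpoch x (q\<^sup>2) N * qpoch (x / q) (q\<^sup>2) N * bilateral q x) \<longlonglongrightarrow>
      qpoch_inf x (q\<^sup>2) * qpoch_inf (x / q) (q\<^sup>2) * bilateral q x"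
    by (intro tendsto_intros qpoch_tendsto norm_power2_less_1 q)
  ultimately show ?thesis
    using LIMSEQ_unique by blast
qed

text \<open>Euler's theorem on odd and distinct parts: the product over all factors splits by
  parity, and (q^2;q^2)_inf = (q;q)_inf (-q;q)_inf, so the even factors cancel.\<close>

lemma qpoch_inf_odd_inverse:
  assumes "q \<noteq> 0" "norm q < 1"
  shows "qpoch_inf q (q\<^sup>2) * qpoch_inf (- q) q = 1"
proof -
  have "qpoch_inf (q\<^sup>2) (q\<^sup>2) \<noteq> 0"
    using assms qpower_neq_1[OF norm_power2_less_1 norm_power2_less_1]
    by (intro qpoch_inf_nonzero norm_power2_less_1) auto
  moreover have "qpoch_inf (q\<^sup>2) (q\<^sup>2) = qpoch_inf q (q\<^sup>2) * qpoch_inf (q * q) (q\<^sup>2) * qpoch_inf (- q) q"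
    unfolding qpoch_inf_square[OF assms(2)] by (subst qpoch_inf_even_odd[OF assms(2), of q]) simp
  ultimately show ?thesis
    by (simp add: power2_eq_square)
qed

text \<open>The constant \<open>bilateral q 0\<close> is eliminated between the instances x = q^2
  and x = -q^2 of \<open>bilateral_product\<close>. The cube collects one factor
  \<open>qpoch_inf (- q) q\<close> from the products at x = -q^2 and two from the square of
  (q;q^2)_inf, its inverse.\<close>

lemma bilateral_eta_quotient:
  assumes q: "q \<noteq> 0" "norm q < 1"
  shows "bilateral q (- q\<^sup>2) = qpoch_inf (q\<^sup>2) (q\<^sup>2) / qpoch_inf (- q) q ^ 3"
proof -
  note q2 = norm_power2_less_1[OF q(2)]
  have "norm q * norm q < norm q * 1"
    using q by (intro mult_strict_left_mono) auto
  hence less: "norm (q\<^sup>2) < norm q" "norm (- (q\<^sup>2)) < norm q"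
    by (simp_all add: norm_mult power2_eq_square)
  have "bilateral_neg q (q\<^sup>2) (Suc n) = 0" for n
    by (simp add: bilateral_neg_def prod.lessThan_Suc_shift del: prod.lessThan_Suc)
  moreover have "bilateral_pos q (q\<^sup>2) n =
      (-1) ^ n * (q\<^sup>2) ^ (n choose 2) * q ^ n / qpoch (q\<^sup>2) (q\<^sup>2) n" for n
    by (simp add: bilateral_pos_def power_square_eq)
  ultimately have 1: "bilateral q (q\<^sup>2) = qpoch_inf q (q\<^sup>2)"
    using sums_unique[OF euler_qpoch_inf_sums[OF q2, of q]] by (simp add: bilateral_def)
  have quot: "q\<^sup>2 / q = q" "- (q\<^sup>2) / q = - q"
    by (simp_all add: power2_eq_square)
  have eq: "qpoch_inf (- (q\<^sup>2)) (q\<^sup>2) * qpoch_inf (- q) (q\<^sup>2) * bilateral q (- (q\<^sup>2)) =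
      qpoch_inf (q\<^sup>2) (q\<^sup>2) * qpoch_inf q (q\<^sup>2) * qpoch_inf q (q\<^sup>2)"
    using bilateral_product[OF q less(1)] bilateral_product[OF q less(2)] unfolding quot 1 by simp
  have 2: "qpoch_inf (- (q\<^sup>2)) (q\<^sup>2) * qpoch_inf (- q) (q\<^sup>2) = qpoch_inf (- q) q"
    using qpoch_inf_even_odd[OF q(2), of "- q"] by (simp add: power2_eq_square mult.commute)
  have 3: "qpoch_inf (- q) q \<noteq> 0" "qpoch_inf q (q\<^sup>2) = 1 / qpoch_inf (- q) q"
    using qpoch_inf_odd_inverse[OF q] by (auto simp: eq_divide_eq)
  show ?thesis
    using eq 3(1) unfolding 2 3(2) by (simp add: field_simps power3_eq_cube)
qed

subsection \<open>Generating functions of multisets of parts\<close>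

lemma has_sum_abs_product:
  fixes f :: "'a \<Rightarrow> 'c :: {real_normed_field, banach}" and g :: "'b \<Rightarrow> 'c"
  assumes "(f has_sum s) A" "(\<lambda>x. norm (f x)) summable_on A"
    and "(g has_sum t) B" "(\<lambda>y. norm (g y)) summable_on B"
  shows "((\<lambda>(x, y). f x * g y) has_sum (s * t)) (A \<times> B)"
    and "(\<lambda>(x, y). norm (f x * g y)) summable_on (A \<times> B)"
proof -
  have abs: "(\<lambda>z. norm (case z of (x, y) \<Rightarrow> f x * g y)) summable_on (A \<times> B)"
    by (rule Infinite_Sum.abs_summable_on_Sigma_iff[THEN iffD2])
       (use assms in \<open>auto simp: norm_mult infsum_cmult_right' abs_mult
         intro!: summable_on_cmult_right summable_on_cmult_left\<close>)
  thus "(\<lambda>(x, y). norm (f x * g y)) summable_on (A \<times> B)"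
    by (simp add: case_prod_unfold)
  have "(\<lambda>(x, y). f x * g y) summable_on (A \<times> B)"
    using abs by (rule abs_summable_summable)
  thus "((\<lambda>(x, y). f x * g y) has_sum (s * t)) (A \<times> B)"
    using assms by (intro has_sum_SigmaI[where g = "\<lambda>x. f x * t"])
      (auto intro: has_sum_cmult_right has_sum_cmult_left)
qed

text \<open>A multiset over \<open>insert a A\<close> is uniquely \<open>m\<close> copies of
  \<open>a\<close> plus a multiset over \<open>A\<close>, so each element contributes a geometric
  series. Absolute summability is carried through the induction because multiplying the two sums
  requires it.\<close>

lemma has_sum_multiset_weight:
  fixes x :: "'c :: {real_normed_field, banach}" and w :: "'a \<Rightarrow> nat"
  assumes "finite A" "norm x < 1" "\<And>a. a \<in> A \<Longrightarrow> w a > 0"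
  shows "((\<lambda>P. x ^ (\<Sum>a\<in>#P. w a)) has_sum (\<Prod>a\<in>A. 1 / (1 - x ^ w a))) {P. set_mset P \<subseteq> A} \<and>
    (\<lambda>P. norm (x ^ (\<Sum>a\<in>#P. w a))) summable_on {P. set_mset P \<subseteq> A}"
  using assms(1,3)
proof (induction A rule: finite_induct)
  case empty
  have "{P :: 'a multiset. set_mset P \<subseteq> {}} = {{#}}"
    by auto
  thus ?case by (simp add: has_sum_finite_iff)
next
  case (insert a A)
  define y where "y = x ^ w a"
  define f where "f P = x ^ (\<Sum>a\<in>#P. w a)" for P
  define h where "h = (\<lambda>(m, P). replicate_mset m a + P)"
  have "norm y < 1"
    using assms(2) insert.prems[of a] by (simp add: y_def norm_power power_less_one_iff)
  hence geo: "((\<lambda>m. y ^ m) has_sum (1 / (1 - y))) UNIV" "(\<lambda>m. norm (y ^ m)) summable_on UNIV"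
    by (auto intro!: norm_summable_imp_has_sum geometric_sums norm_summable_imp_summable_on
        simp: norm_power summable_geometric)
  have inj: "inj_on h (UNIV \<times> {P. set_mset P \<subseteq> A})"
  proof (rule inj_onI, clarify)
    fix m P n R
    assume *: "set_mset P \<subseteq> A" "set_mset R \<subseteq> A" "h (m, P) = h (n, R)"
    hence "count P a = 0" "count R a = 0"
      using insert.hyps by (auto simp: count_eq_zero_iff)
    moreover have "count (h (m, P)) a = count (h (n, R)) a"
      using * by simp
    ultimately have "m = n"
      by (simp add: h_def)
    thus "m = n \<and> P = R"
      using * by (simp add: h_def)
  qed
  have img: "h ` (UNIV \<times> {P. set_mset P \<subseteq> A}) = {P. set_mset P \<subseteq> insert a A}"
  proof (intro equalityI subsetI)
    fix P assume "P \<in> {P. set_mset P \<subseteq> insert a A}"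
    hence "set_mset (filter_mset (\<lambda>b. b \<noteq> a) P) \<subseteq> A"
      by auto
    moreover have "P = h (count P a, filter_mset (\<lambda>b. b \<noteq> a) P)"
      by (auto simp: h_def multiset_eq_iff)
    ultimately show "P \<in> h ` (UNIV \<times> {P. set_mset P \<subseteq> A})"
      by blast
  qed (auto simp: h_def split: if_splits)
  have fh: "f (h z) = (case z of (m, P) \<Rightarrow> y ^ m * f P)" for z
    by (cases z) (simp add: f_def h_def y_def power_add mult.commute flip: power_mult)
  have IH: "(f has_sum (\<Prod>a\<in>A. 1 / (1 - x ^ w a))) {P. set_mset P \<subseteq> A}"
    "(\<lambda>P. norm (f P)) summable_on {P. set_mset P \<subseteq> A}"
    using insert unfolding f_def by auto
  have "((f \<circ> h) has_sum (1 / (1 - y) * (\<Prod>a\<in>A. 1 / (1 - x ^ w a)))) (UNIV \<times> {P. set_mset P \<subseteq> A})"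
    using has_sum_abs_product(1)[OF geo IH] by (simp add: fh o_def)
  hence 1: "(f has_sum (\<Prod>a\<in>insert a A. 1 / (1 - x ^ w a))) {P. set_mset P \<subseteq> insert a A}"
    unfolding has_sum_reindex[OF inj, symmetric] img using insert.hyps by (simp add: y_def)
  have "((\<lambda>P. norm (f P)) \<circ> h) summable_on (UNIV \<times> {P. set_mset P \<subseteq> A})"
    using has_sum_abs_product(2)[OF geo IH] by (simp add: fh o_def case_prod_unfold)
  hence 2: "(\<lambda>P. norm (f P)) summable_on {P. set_mset P \<subseteq> insert a A}"
    unfolding summable_on_reindex[OF inj, symmetric] img .
  from 1 2 show ?case
    unfolding f_def by blast
qed

text \<open>Every finite subset of the union already lies in some \<open>S N\<close>. Summability
  over the union is assumed because convergence of \<open>s\<close> alone does not imply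
  unconditional summability.\<close>

lemma has_sum_incseq_UN:
  fixes f :: "'a \<Rightarrow> 'b :: {real_normed_vector}"
  assumes "f summable_on (\<Union>n. S n)" "incseq S" "\<And>n. (f has_sum s n) (S n)" "s \<longlonglongrightarrow> l"
  shows "(f has_sum l) (\<Union>n. S n)"
proof -
  obtain t where t: "(f has_sum t) (\<Union>n. S n)"
    using assms(1) by (auto simp: summable_on_def)
  have "s \<longlonglongrightarrow> t"
  proof (rule LIMSEQ_I)
    fix e :: real assume "e > 0"
    hence "\<forall>\<^sub>F Y in finite_subsets_at_top (\<Union>n. S n). dist (sum f Y) t < e / 2"
      using t unfolding has_sum_def by (intro tendstoD) auto
    then obtain X where X: "finite X" "X \<subseteq> (\<Union>n. S n)"
      "\<forall>Y. finite Y \<and> X \<subseteq> Y \<and> Y \<subseteq> (\<Union>n. S n) \<longrightarrow> dist (sum f Y) t < e / 2"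
      unfolding eventually_finite_subsets_at_top by metis
    have "\<exists>N. X \<subseteq> S N"
      using X(1,2)
    proof (induction X rule: finite_induct)
      case (insert x X)
      then obtain N M where "X \<subseteq> S N" "x \<in> S M" by auto
      hence "insert x X \<subseteq> S (max N M)"
        using incseqD[OF assms(2), of N "max N M"] incseqD[OF assms(2), of M "max N M"] by auto
      thus ?case by blast
    qed simp
    then obtain N where N: "X \<subseteq> S N" by blast
    have "norm (s n - t) < e" if "n \<ge> N" for n
    proof -
      have "\<forall>\<^sub>F Y in finite_subsets_at_top (S n). dist (sum f Y) t \<le> e / 2"
        unfolding eventually_finite_subsets_at_top
      proof (intro exI[of _ X] conjI allI impI)
        show "X \<subseteq> S n"
          using N incseqD[OF assms(2) that] by (rule order.trans)
        fix Y assume "finite Y \<and> X \<subseteq> Y \<and> Y \<subseteq> S n"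
        hence "dist (sum f Y) t < e / 2"
          by (intro X(3)[rule_format]) auto
        thus "dist (sum f Y) t \<le> e / 2"
          by simp
      qed (rule X(1))
      moreover have "((\<lambda>Y. dist (sum f Y) t) \<longlongrightarrow> dist (s n) t) (finite_subsets_at_top (S n))"
        using assms(3)[of n] unfolding has_sum_def by (intro tendsto_intros)
      ultimately have "dist (s n) t \<le> e / 2"
        by (intro tendsto_upperbound) auto
      thus ?thesis
        using \<open>e > 0\<close> by (simp add: dist_norm)
    qed
    thus "\<exists>N. \<forall>n\<ge>N. norm (s n - t) < e" by blast
  qed
  hence "t = l"
    using assms(4) LIMSEQ_unique by blast
  thus ?thesis using t by simp
qed

lemma has_sum_disjoint_UN:
  fixes f :: "'a \<Rightarrow> 'b :: banach"
  assumes "(f has_sum s) (\<Union>n. C n)" "disjoint_family C" "\<And>n. (f has_sum g n) (C n)"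
  shows "(g has_sum s) UNIV"
proof -
  have inj: "inj_on snd (Sigma UNIV C)"
    using assms(2) by (fastforce simp: inj_on_def disjoint_family_on_def)
  have img: "snd ` Sigma UNIV C = (\<Union>n. C n)"
    by force
  have "((f \<circ> snd) has_sum s) (Sigma UNIV C)"
    using assms(1) unfolding has_sum_reindex[OF inj, symmetric] img .
  thus ?thesis
    by (rule has_sum_SigmaD) (use assms(3) in simp)
qed

section \<open>Two-coloured partitions sorted by their smallest part\<close>

definition weight :: "(nat \<times> color) multiset \<Rightarrow> nat" where
  "weight P = (\<Sum>p\<in>#P. fst p)"

text \<open>A finite set of partitions involves only parts up to some \<open>N\<close>, so its sum
  is at most the product of 1 / (1 - r^k)^2 over k up to \<open>N\<close>, where
  \<open>r = norm q\<close> and the square accounts for the two colours. These products are bounded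
  since (r;r)_N has a nonzero limit.\<close>

lemma abs_summable_two_color_partitions:
  fixes q :: complex
  assumes q: "norm q < 1"
  shows "(\<lambda>P. norm (q ^ weight P)) summable_on {P. \<forall>p\<in>#P. fst p > 0}"
proof -
  define r where "r = norm q"
  have r: "norm (complex_of_real r) < 1" "norm r < 1" "r \<ge> 0"
    using q by (simp_all add: r_def)
  from inverse_qpoch_bounded[OF r(1) qpower_neq_1[OF r(1) r(1)]]
  obtain C where C: "C > 0" "\<And>n. norm (inverse (qpoch (of_real r) (of_real r) n)) \<le> C"
    by blast
  define A where "A N = Suc ` {..<N} \<times> {Red, Blue}" for N
  have prod: "(\<Prod>a\<in>A N. 1 / (1 - r ^ fst a)) = (norm (inverse (qpoch (of_real r) (of_real r) N)))\<^sup>2" for N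
  proof -
    have "(\<Prod>a\<in>A N. 1 / (1 - r ^ fst a)) = (\<Prod>k<N. 1 / (1 - r ^ Suc k))\<^sup>2"
      unfolding A_def power2_eq_square prod.distrib [symmetric] prod.cartesian_product'
      by (simp add: prod.reindex)
    also have "(\<Prod>k<N. 1 / (1 - r ^ Suc k)) = norm (inverse (qpoch (of_real r) (of_real r) N))"
    proof -
      have "1 - complex_of_real r * of_real r ^ k = of_real (1 - r ^ Suc k)" for k
        by simp
      moreover have "norm (complex_of_real (1 - r ^ Suc k)) = 1 - r ^ Suc k" for k
        using r power_le_one[of r "Suc k"] by (simp only: norm_of_real) simp
      ultimately show ?thesis
        unfolding qpoch_def norm_inverse prod_norm[symmetric]
        by (simp only:) (simp add: prod_dividef divide_inverse flip: prod_inversef)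
    qed
    finally show ?thesis .
  qed
  have "(\<lambda>P. r ^ weight P) summable_on {P. \<forall>p\<in>#P. fst p > 0}"
  proof (rule nonneg_bdd_above_summable_on)
    show "bdd_above (sum (\<lambda>P. r ^ weight P) ` {F. F \<subseteq> {P. \<forall>p\<in>#P. 0 < fst p} \<and> finite F})"
    proof (rule bdd_aboveI2)
      fix F assume "F \<in> {F. F \<subseteq> {P :: (nat \<times> color) multiset. \<forall>p\<in>#P. 0 < fst p} \<and> finite F}"
      hence F: "finite F" "\<And>P p. P \<in> F \<Longrightarrow> p \<in># P \<Longrightarrow> 0 < fst p" by auto
      define N where "N = Suc (\<Sum>P\<in>F. weight P)"
      have "set_mset P \<subseteq> A N" if P: "P \<in> F" for P
      proof
        fix p assume p: "p \<in># P"
        have "fst p \<le> weight P"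
          using p by (auto simp: weight_def dest!: multi_member_split)
        also have "\<dots> \<le> (\<Sum>P\<in>F. weight P)"
          using P F(1) by (simp add: member_le_sum)
        finally have "fst p \<in> Suc ` {..<N}"
          using F(2)[OF P p] by (cases "fst p") (auto simp: N_def)
        thus "p \<in> A N"
          unfolding A_def by (cases p; cases "snd p") auto
      qed
      hence sub: "F \<subseteq> {P. set_mset P \<subseteq> A N}" by auto
      have "((\<lambda>P. r ^ weight P) has_sum (\<Prod>a\<in>A N. 1 / (1 - r ^ fst a))) {P. set_mset P \<subseteq> A N}"
        unfolding weight_def using r by (intro has_sum_multiset_weight[THEN conjunct1]) (auto simp: A_def)
      hence "sum (\<lambda>P. r ^ weight P) F \<le> (\<Prod>a\<in>A N. 1 / (1 - r ^ fst a))"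
        by (rule has_sum_mono2[OF has_sum_finiteI[OF F(1) refl] _ sub]) (use r in auto)
      also have "\<dots> \<le> C\<^sup>2"
        unfolding prod by (intro power_mono C) simp
      finally show "sum (\<lambda>P. r ^ weight P) F \<le> C\<^sup>2" .
    qed
  qed (use r in auto)
  thus ?thesis
    by (simp add: norm_power r_def)
qed

definition parts_from :: "nat \<Rightarrow> (nat \<times> color) set" where
  "parts_from m = {(k, Blue) |k. k \<ge> 2 * m + 1} \<union> {(k, Red) |k. even k \<and> k \<in> {2 * m <.. 4 * m}}"

text \<open>\<open>has_sum_multiset_weight\<close> applies to finite sets of parts only, so the blue
  parts are cut off to \<open>N\<close> consecutive sizes and \<open>N\<close> tends to
  infinity.\<close>

lemma has_sum_parts_from:
  fixes q :: complex
  assumes q: "norm q < 1"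
  shows "((\<lambda>P. q ^ weight P) has_sum
    (1 / (qpoch_inf (q ^ (2 * m + 1)) q * qpoch (q ^ (2 * m + 2)) (q\<^sup>2) m)))
    {P. set_mset P \<subseteq> parts_from m}"
proof -
  \<comment> \<open>The even numbers in (2m, 4m] are the \<open>m\<close> numbers 2m + 2 + 2k with k
    < m, which are the exponents in \<open>qpoch (q ^ (2 * m + 2)) (q\<^sup>2) m\<close>; there are
    none for \<open>m = 0\<close>.\<close>
  define R where "R = (\<lambda>k. (2 * m + 2 + 2 * k, Red)) ` {..<m}"
  define B where "B N = (\<lambda>k. (2 * m + 1 + k, Blue)) ` {..<N}" for N
  define S where "S N = {P. set_mset P \<subseteq> B N \<union> R}" for N
  have R: "R = {(k, Red) |k. even k \<and> k \<in> {2 * m <.. 4 * m}}"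
  proof (intro equalityI subsetI)
    fix p assume "p \<in> {(k, Red) |k. even k \<and> k \<in> {2 * m <.. 4 * m}}"
    then obtain j where "p = (2 * j, Red)" "m < j" "j \<le> 2 * m"
      by (auto elim!: evenE)
    thus "p \<in> R"
      unfolding R_def by (intro image_eqI[of _ _ "j - m - 1"]) auto
  qed (auto simp: R_def)
  have B: "(\<Union>N. B N) = {(k, Blue) |k. k \<ge> 2 * m + 1}"
  proof (intro equalityI subsetI)
    fix p assume "p \<in> {(k, Blue) |k. k \<ge> 2 * m + 1}"
    then obtain k where "p = (k, Blue)" "k \<ge> 2 * m + 1" by auto
    hence "p \<in> B (Suc k)"
      unfolding B_def by (intro image_eqI[of _ _ "k - (2 * m + 1)"]) auto
    thus "p \<in> (\<Union>N. B N)" by blast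
  qed (auto simp: B_def)
  have parts: "parts_from m = (\<Union>N. B N) \<union> R"
    unfolding R B parts_from_def ..
  have inc: "incseq S"
    unfolding incseq_def S_def B_def by (force intro: order.trans)
  have U: "(\<Union>N. S N) = {P. set_mset P \<subseteq> parts_from m}"
  proof (intro equalityI subsetI)
    fix P assume "P \<in> {P. set_mset P \<subseteq> parts_from m}"
    hence P: "set_mset P \<subseteq> (\<Union>N. B N) \<union> R"
      unfolding parts by simp
    have "set_mset P \<subseteq> B (Suc (weight P)) \<union> R"
    proof
      fix p assume p: "p \<in># P"
      have "fst p \<le> weight P"
        using p by (auto simp: weight_def dest!: multi_member_split)
      moreover from P p have "p \<in> R \<or> (\<exists>N. p \<in> B N)" by auto
      ultimately show "p \<in> B (Suc (weight P)) \<union> R"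
        unfolding B_def by auto
    qed
    thus "P \<in> (\<Union>N. S N)" unfolding S_def by blast
  next
    fix P assume "P \<in> (\<Union>N. S N)"
    thus "P \<in> {P. set_mset P \<subseteq> parts_from m}"
      unfolding parts S_def by blast
  qed
  have sm: "(\<lambda>P. q ^ weight P) summable_on (\<Union>N. S N)"
    unfolding U
  proof (rule summable_on_subset_banach)
    show "(\<lambda>P. q ^ weight P) summable_on {P. \<forall>p\<in>#P. fst p > 0}"
      using abs_summable_two_color_partitions[OF q] by (rule abs_summable_summable)
  qed (force simp: parts_from_def)
  have fin: "((\<lambda>P. q ^ weight P) has_sum
      (1 / (qpoch (q ^ (2 * m + 1)) q N * qpoch (q ^ (2 * m + 2)) (q\<^sup>2) m))) (S N)" for N
  proof -
    have "((\<lambda>P. q ^ weight P) has_sum (\<Prod>a\<in>B N \<union> R. 1 / (1 - q ^ fst a))) (S N)"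
      unfolding weight_def S_def using q
      by (intro has_sum_multiset_weight[THEN conjunct1]) (auto simp: B_def R_def)
    also have "(\<Prod>a\<in>B N \<union> R. 1 / (1 - q ^ fst a)) =
        (\<Prod>a\<in>B N. 1 / (1 - q ^ fst a)) * (\<Prod>a\<in>R. 1 / (1 - q ^ fst a))"
      by (rule prod.union_disjoint) (auto simp: B_def R_def)
    also have "(\<Prod>a\<in>B N. 1 / (1 - q ^ fst a)) = 1 / qpoch (q ^ (2 * m + 1)) q N"
      unfolding B_def qpoch_def
      by (subst prod.reindex) (auto simp: inj_on_def prod_dividef power_add mult_ac)
    also have "(\<Prod>a\<in>R. 1 / (1 - q ^ fst a)) = 1 / qpoch (q ^ (2 * m + 2)) (q\<^sup>2) m"
      unfolding R_def qpoch_def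
      by (subst prod.reindex) (auto simp: inj_on_def prod_dividef power_add power_mult power2_eq_square power_mult_distrib mult_ac)
    finally show ?thesis by simp
  qed
  have pole: "q ^ (2 * m + 1) * q ^ k \<noteq> 1" "q ^ (2 * m + 2) * (q\<^sup>2) ^ k \<noteq> 1" for k
  proof -
    have *: "q ^ Suc n \<noteq> 1" for n
      using qpower_neq_1[OF q q, of n] by simp
    have "q ^ (2 * m + 1) * q ^ k = q ^ Suc (2 * m + k)" "q ^ (2 * m + 2) * (q\<^sup>2) ^ k = q ^ Suc (2 * m + 2 * k + 1)"
      by (simp_all add: power_add power_mult)
    thus "q ^ (2 * m + 1) * q ^ k \<noteq> 1" "q ^ (2 * m + 2) * (q\<^sup>2) ^ k \<noteq> 1"
      using * by (simp_all only:) blast+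
  qed
  show ?thesis
    unfolding U[symmetric]
    by (rule has_sum_incseq_UN[OF sm inc fin])
       (intro tendsto_intros qpoch_tendsto q no_zero_divisors qpoch_inf_nonzero qpoch_nonzero pole)
qed

definition G'_min :: "nat \<Rightarrow> (nat \<times> color) multiset set" where
  "G'_min m = {P. G'_partition P \<and> Min (fst ` set_mset P) = 2 * m + 1}"

text \<open>The smallest part is odd and red parts are even, so it is blue. Removing one copy leaves
  an arbitrary multiset over \<open>parts_from m\<close>, since the smallest part may recur; the
  removed copy accounts for the numerator q^(2m+1).\<close>

lemma G'_min_eq: "G'_min m = add_mset (2 * m + 1, Blue) ` {P. set_mset P \<subseteq> parts_from m}"
proof (intro equalityI subsetI)
  fix P assume "P \<in> G'_min m"
  hence P: "P \<noteq> {#}" "Min (fst ` set_mset P) = 2 * m + 1"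
    "\<And>k. (k, Red) \<in># P \<Longrightarrow> even k \<and> k \<in> {2 * m <.. 4 * m}"
    by (auto simp: G'_min_def G'_partition_def)
  have "Min (fst ` set_mset P) \<in> fst ` set_mset P"
    using P(1) by (intro Min_in) auto
  then obtain c where c: "(2 * m + 1, c) \<in># P"
    unfolding P(2) by auto
  have "c = Blue"
    using c P(3)[of "2 * m + 1"] by (cases c) auto
  have "set_mset P \<subseteq> parts_from m"
  proof
    fix p assume p: "p \<in># P"
    hence "fst p \<ge> 2 * m + 1"
      unfolding P(2)[symmetric] by simp
    thus "p \<in> parts_from m"
      using p P(3)[of "fst p"] unfolding parts_from_def by (cases p; cases "snd p") auto
  qed
  hence "set_mset (P - {#(2 * m + 1, c)#}) \<subseteq> parts_from m"
    by (auto dest: in_diffD)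
  moreover have "P = add_mset (2 * m + 1, Blue) (P - {#(2 * m + 1, c)#})"
    using c \<open>c = Blue\<close> by simp
  ultimately show "P \<in> add_mset (2 * m + 1, Blue) ` {P. set_mset P \<subseteq> parts_from m}"
    by blast
next
  fix P assume "P \<in> add_mset (2 * m + 1, Blue) ` {P. set_mset P \<subseteq> parts_from m}"
  then obtain R where R: "P = add_mset (2 * m + 1, Blue) R" "set_mset R \<subseteq> parts_from m"
    by auto
  have "Min (fst ` set_mset P) = 2 * m + 1"
    using R by (intro Min_eqI) (auto simp: parts_from_def)
  moreover have "even k \<and> k \<in> {2 * m <.. 4 * m}" if "(k, Red) \<in># P" for k
    using that R by (auto simp: parts_from_def)
  ultimately show "P \<in> G'_min m"
    using R unfolding G'_min_def G'_partition_def by auto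
qed

text \<open>One absolutely convergent sum over all counted partitions is grouped in two ways, by
  smallest part and by weight; both series therefore have the same sum \<open>s\<close>.\<close>

lemma G'_generating_function:
  fixes q :: complex
  assumes q: "norm q < 1"
  obtains s where "(\<lambda>n. of_nat (G' n) * q ^ n) sums s"
    and "(\<lambda>m. q ^ (2 * m + 1) /
      (qpoch_inf (q ^ (2 * m + 1)) q * qpoch (q ^ (2 * m + 2)) (q\<^sup>2) m)) sums s"
proof -
  have pos: "fst p > 0" if P: "G'_partition P" "p \<in># P" for P p
  proof -
    obtain m where "Min (fst ` set_mset P) = 2 * m + 1"
      using P by (auto simp: G'_partition_def)
    moreover have "Min (fst ` set_mset P) \<le> fst p"
      using P by simp
    ultimately show ?thesis by simp
  qed
  have "(\<lambda>P. q ^ weight P) summable_on {P. G'_partition P}"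
  proof (rule summable_on_subset_banach)
    show "(\<lambda>P. q ^ weight P) summable_on {P. \<forall>p\<in>#P. fst p > 0}"
      using abs_summable_two_color_partitions[OF q] by (rule abs_summable_summable)
  qed (use pos in auto)
  then obtain s where s: "((\<lambda>P. q ^ weight P) has_sum s) {P. G'_partition P}"
    by (auto simp: summable_on_def)
  have U1: "{P. G'_partition P} = (\<Union>m. G'_min m)"
    by (auto simp: G'_min_def G'_partition_def)
  have "((\<lambda>P. q ^ weight P) has_sum (q ^ (2 * m + 1) /
      (qpoch_inf (q ^ (2 * m + 1)) q * qpoch (q ^ (2 * m + 2)) (q\<^sup>2) m))) (G'_min m)" for m
  proof -
    have "inj_on (add_mset (2 * m + 1, Blue)) {P. set_mset P \<subseteq> parts_from m}"
      by (auto simp: inj_on_def)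
    moreover have "q ^ weight (add_mset (2 * m + 1, Blue) P) = q ^ (2 * m + 1) * q ^ weight P" for P
      by (simp add: weight_def power_add)
    ultimately show ?thesis
      unfolding G'_min_eq
      using has_sum_cmult_right[OF has_sum_parts_from[OF q, of m], of "q ^ (2 * m + 1)"]
      by (subst has_sum_reindex) (simp_all only: o_def times_divide_eq_right mult_1_right)
  qed
  hence 1: "((\<lambda>m. q ^ (2 * m + 1) /
      (qpoch_inf (q ^ (2 * m + 1)) q * qpoch (q ^ (2 * m + 2)) (q\<^sup>2) m)) has_sum s) UNIV"
    using s unfolding U1
    by (intro has_sum_disjoint_UN[where C = G'_min]) (auto simp: disjoint_family_on_def G'_min_def)
  define C where "C n = {P \<in> two_color_partitions n. G'_partition P}" for n
  have U2: "{P. G'_partition P} = (\<Union>n. C n)"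
    using pos by (auto simp: C_def two_color_partitions_def)
  have "((\<lambda>P. q ^ weight P) has_sum (of_nat (G' n) * q ^ n)) (C n)" for n
  proof -
    \<comment> \<open>Finiteness makes the \<open>card\<close> in \<open>G'\<close> a true count:
      parts are positive, so there are at most \<open>n\<close> of them, each of size at most
      \<open>n\<close>.\<close>
    have "C n \<subseteq> (\<Union>k\<le>n. multisets_of_size ({..n} \<times> {Red, Blue}) k)"
    proof
      fix P assume "P \<in> C n"
      hence P: "\<And>p. p \<in># P \<Longrightarrow> fst p > 0" "(\<Sum>p\<in>#P. fst p) = n"
        by (auto simp: C_def two_color_partitions_def)
      have "size P = (\<Sum>p\<in>#P. 1)"
        by simp
      also have "\<dots> \<le> (\<Sum>p\<in>#P. fst p)"
        using P(1) by (intro sum_mset_mono) (simp add: Suc_leI)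
      finally have "size P \<le> n"
        using P(2) by simp
      moreover have "p \<in> {..n} \<times> {Red, Blue}" if "p \<in># P" for p
      proof -
        have "fst p \<le> n"
          using that P(2) by (auto dest!: multi_member_split)
        thus ?thesis by (cases p; cases "snd p") auto
      qed
      ultimately show "P \<in> (\<Union>k\<le>n. multisets_of_size ({..n} \<times> {Red, Blue}) k)"
        by (auto simp: multisets_of_size_def)
    qed
    hence "finite (C n)"
      by (rule finite_subset) auto
    moreover have "(\<Sum>P\<in>C n. q ^ weight P) = (\<Sum>P\<in>C n. q ^ n)"
      by (intro sum.cong) (auto simp: C_def two_color_partitions_def weight_def)
    ultimately show ?thesis
      by (intro has_sum_finiteI) (auto simp: G'_def C_def)
  qed
  hence 2: "((\<lambda>n. of_nat (G' n) * q ^ n) has_sum s) UNIV"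
    using s unfolding U2
    by (intro has_sum_disjoint_UN[where C = C]) (auto simp: disjoint_family_on_def C_def two_color_partitions_def)
  show ?thesis
    using that has_sum_imp_sums[OF 1] has_sum_imp_sums[OF 2] by blast
qed

subsection \<open>Evaluation of the generating function\<close>

text \<open>Expanding the denominators geometrically turns both series into the double series
  \<open>f\<close>, summed over \<open>n\<close> first or over \<open>j\<close> first. Since
  (2j+1)(n+1) is at least j + n, a product of two geometric series dominates it.\<close>

lemma lambert_sums_eq:
  fixes q :: complex
  assumes q: "norm q < 1"
  obtains s where "(\<lambda>j. (-1) ^ j * q ^ (2 * j + 1) / (1 + q ^ (2 * j + 1))) sums s"
    and "(\<lambda>n. (-1) ^ n * q ^ (n + 1) / (1 + (q\<^sup>2) ^ (n + 1))) sums s"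
proof -
  define f where "f = (\<lambda>(j, n). (-1) ^ (j + n) * q ^ ((2 * j + 1) * (n + 1)))"
  have geo: "((\<lambda>k. norm q ^ k) has_sum (1 / (1 - norm q))) UNIV" "(\<lambda>k. norm (norm q ^ k)) summable_on UNIV"
    using q by (auto intro!: norm_summable_imp_has_sum geometric_sums norm_summable_imp_summable_on
        simp: summable_geometric)
  have "(\<lambda>z. norm (f z)) summable_on UNIV \<times> UNIV"
  proof (rule Infinite_Sum.abs_summable_on_comparison_test')
    show "(\<lambda>(j, n). norm (norm q ^ j * norm q ^ n)) summable_on UNIV \<times> UNIV"
      by (rule has_sum_abs_product(2)[OF geo geo])
    fix z :: "nat \<times> nat"
    obtain j n where z: "z = (j, n)" by (cases z)
    have "norm (f z) = norm q ^ ((2 * j + 1) * (n + 1))"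
      by (simp add: z f_def norm_mult norm_power)
    also have "\<dots> \<le> norm q ^ (j + n)"
      using q by (intro power_decreasing) auto
    finally show "norm (f z) \<le> (case z of (j, n) \<Rightarrow> norm (norm q ^ j * norm q ^ n))"
      by (simp add: z power_add)
  qed
  hence "f summable_on UNIV \<times> UNIV"
    by (rule abs_summable_summable)
  then obtain s where s: "(f has_sum s) (UNIV \<times> UNIV)"
    by (auto simp: summable_on_def)
  have geom: "((\<lambda>n. (-1) ^ n * y ^ n) has_sum (1 / (1 + y))) UNIV" if "norm y < 1" for y :: complex
  proof -
    have "((\<lambda>n. (- y) ^ n) has_sum (1 / (1 - (- y)))) UNIV"
      using that by (intro norm_summable_imp_has_sum geometric_sums) (auto simp: norm_power summable_geometric)
    thus ?thesis by (simp add: power_minus[of y])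
  qed
  have small: "norm (q ^ Suc n) < 1" for n
    unfolding norm_power power_less_one_iff[OF norm_ge_zero] using q by simp
  have "((\<lambda>n. f (j, n)) has_sum ((-1) ^ j * q ^ (2 * j + 1) / (1 + q ^ (2 * j + 1)))) UNIV" for j
  proof -
    have "q ^ ((2 * j + 1) * (n + 1)) = q ^ (2 * j + 1) * (q ^ (2 * j + 1)) ^ n" for n
      by (metis Suc_eq_plus1 power_Suc power_mult)
    hence "f (j, n) = (-1) ^ j * q ^ (2 * j + 1) * ((-1) ^ n * (q ^ (2 * j + 1)) ^ n)" for n
      by (simp only: f_def prod.case power_add[of "- 1"] mult_ac)
    thus ?thesis
      using has_sum_cmult_right[OF geom[OF small[of "2 * j"]], of "(-1) ^ j * q ^ (2 * j + 1)"] by simp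
  qed
  hence 1: "((\<lambda>j. (-1) ^ j * q ^ (2 * j + 1) / (1 + q ^ (2 * j + 1))) has_sum s) UNIV"
    by (rule has_sum_SigmaD[OF s])
  have s': "((f \<circ> prod.swap) has_sum s) (UNIV \<times> UNIV)"
    using s by (subst has_sum_reindex [symmetric]) auto
  have "((\<lambda>j. (f \<circ> prod.swap) (n, j)) has_sum ((-1) ^ n * q ^ (n + 1) / (1 + (q\<^sup>2) ^ (n + 1)))) UNIV" for n
  proof -
    have "norm ((q\<^sup>2) ^ (n + 1)) < 1"
      unfolding norm_power[of "q\<^sup>2"] power_less_one_iff[OF norm_ge_zero]
      using norm_power2_less_1[OF q] by simp
    note has_sum_cmult_right[OF geom[OF this], of "(-1) ^ n * q ^ (n + 1)"]
    moreover have "(f \<circ> prod.swap) (n, j) = (-1) ^ n * q ^ (n + 1) * ((-1) ^ j * ((q\<^sup>2) ^ (n + 1)) ^ j)" for j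
    proof -
      have "(2 * j + 1) * (n + 1) = (n + 1) + 2 * (n + 1) * j"
        by (simp add: algebra_simps)
      hence "q ^ ((2 * j + 1) * (n + 1)) = q ^ (n + 1) * ((q\<^sup>2) ^ (n + 1)) ^ j"
        by (simp only: power_add power_mult)
      thus ?thesis
        by (simp only: f_def o_def prod.swap_def fst_conv snd_conv prod.case power_add[of "- 1"] mult_ac)
    qed
    ultimately show ?thesis by simp
  qed
  hence 2: "((\<lambda>n. (-1) ^ n * q ^ (n + 1) / (1 + (q\<^sup>2) ^ (n + 1))) has_sum s) UNIV"
    by (rule has_sum_SigmaD[OF s'])
  show ?thesis
    using that has_sum_imp_sums[OF 1] has_sum_imp_sums[OF 2] by blast
qed

section \<open>Specialisation to base q^2 with parameters -1 and -1/q\<close>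

context
  fixes q :: complex
  assumes q: "q \<noteq> 0" "norm q < 1"
begin

lemma base_facts:
  "norm (q\<^sup>2) < 1" "norm (- (q\<^sup>2)) < norm q"
proof -
  have "norm q * norm q < norm q * 1"
    using q by (intro mult_strict_left_mono) auto
  thus "norm (- (q\<^sup>2)) < norm q"
    by (simp add: norm_mult power2_eq_square)
  thus "norm (q\<^sup>2) < 1" using q by simp
qed

lemma nonpole_minus_inverse: "- 1 / q * (q\<^sup>2) ^ k \<noteq> 1"
proof (cases k)
  case 0
  thus ?thesis using q by (auto simp: field_simps)
next
  case (Suc j)
  have "- 1 / q * (q\<^sup>2) ^ k = - q * (q\<^sup>2) ^ j"
    using q by (simp add: Suc power2_eq_square)
  thus ?thesis
    using qpower_neq_1[OF base_facts(1), of "- q" j] q by simp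
qed

lemma nonpole_minus_1: "- 1 * (q\<^sup>2) ^ k \<noteq> 1"
proof (cases k)
  case (Suc j)
  thus ?thesis
    using qpower_neq_1[OF base_facts(1), of "- (q\<^sup>2)" j] base_facts(1) by simp
qed simp

text \<open>With r = -q^2 and b = -1/q one has b r = q, so \<open>fine_sum\<close> yields (-1)^m
  q^(m^2) over a symbol of length m + 1. Such a term equals \<open>u m + q * u (Suc m)\<close>, and
  the missing \<open>u 0 = 1\<close> causes the correction \<open>- q\<close>.\<close>

lemma fine_sum_phi3:
  "(\<lambda>k. (- (q\<^sup>2)) ^ k * qpoch (- 1 / q) (q\<^sup>2) k) sums ((1 + q) * (\<Sum>n. bilateral_pos q (- (q\<^sup>2)) n) - q)"
proof -
  define u where "u = bilateral_pos q (- (q\<^sup>2))"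
  have su: "summable u"
    using summable_bilateral(1)[OF q base_facts(2), of 0] by (simp add: u_def)
  have "(\<lambda>k. (- (q\<^sup>2)) ^ k * qpoch (- 1 / q) (q\<^sup>2) k) sums
      (\<Sum>m. (-1) ^ m * (q\<^sup>2) ^ (m choose 2) * (- 1 / q * - (q\<^sup>2)) ^ m / qpoch (- (q\<^sup>2)) (q\<^sup>2) (Suc m))"
    using base_facts(1) by (intro fine_sum) auto
  also have "(\<lambda>m. (-1) ^ m * (q\<^sup>2) ^ (m choose 2) * (- 1 / q * - (q\<^sup>2)) ^ m / qpoch (- (q\<^sup>2)) (q\<^sup>2) (Suc m)) =
      (\<lambda>m. u m + q * u (Suc m))"
  proof
    fix m
    define P where "P = (-1) ^ m * q ^ m\<^sup>2 / qpoch (- (q\<^sup>2)) (q\<^sup>2) (Suc m)"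
    have nz: "1 + q\<^sup>2 * (q\<^sup>2) ^ m \<noteq> 0"
      using x_nonpole[OF q base_facts(2), of m] by (auto simp: add_eq_0_iff)
    have "- 1 / q * - (q\<^sup>2) = q"
      using q by (simp add: power2_eq_square)
    hence 1: "(-1) ^ m * (q\<^sup>2) ^ (m choose 2) * (- 1 / q * - (q\<^sup>2)) ^ m / qpoch (- (q\<^sup>2)) (q\<^sup>2) (Suc m) = P"
      by (simp add: P_def power_square_eq)
    have 2: "u m = P * (1 + q\<^sup>2 * (q\<^sup>2) ^ m)"
      using nz by (simp add: P_def u_def bilateral_pos_def qpoch_Suc)
    have "(Suc m)\<^sup>2 = m\<^sup>2 + 2 * m + 1"
      by (simp add: power2_eq_square)
    hence "q ^ (Suc m)\<^sup>2 = q ^ m\<^sup>2 * (q\<^sup>2) ^ m * q"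
      by (simp only: power_add power_mult power_one_right)
    hence 3: "u (Suc m) = - P * (q\<^sup>2) ^ m * q"
      by (simp add: P_def u_def bilateral_pos_def)
    show "(-1) ^ m * (q\<^sup>2) ^ (m choose 2) * (- 1 / q * - (q\<^sup>2)) ^ m / qpoch (- (q\<^sup>2)) (q\<^sup>2) (Suc m) = u m + q * u (Suc m)"
      unfolding 1 2 3 by (simp add: algebra_simps power2_eq_square)
  qed
  also have "suminf (\<lambda>m. u m + q * u (Suc m)) = suminf u + q * (\<Sum>m. u (Suc m))"
    using su by (subst suminf_add [symmetric]) (auto simp: suminf_mult summable_Suc_iff intro!: summable_mult)
  also have "(\<Sum>m. u (Suc m)) = suminf u - 1"
    using suminf_split_head[OF su] by (simp add: u_def bilateral_pos_def)
  finally show ?thesis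
    by (simp add: u_def algebra_simps)
qed

text \<open>The negative half is itself a series of this type, with ratio \<open>- q\<close> instead
  of \<open>- (q ^ 3)\<close>. Writing (q^2)^k as (1 + (q^2)^k) - 1 expresses each summand by two
  consecutive terms of it.\<close>

lemma fine_sum_psi:
  "(\<lambda>k. (- (q ^ 3)) ^ k * qpoch (- 1) (q\<^sup>2) k) sums
    (- (1 + 1 / q) * (\<Sum>n. bilateral_neg q (- (q\<^sup>2)) (Suc n)) - 1)"
proof -
  define v where "v = bilateral_neg q (- (q\<^sup>2))"
  have sv: "summable (\<lambda>n. v (Suc n))"
    using summable_bilateral(2)[OF q base_facts(2), of 0] by (simp add: v_def)
  have v: "v n = (- q) ^ n * qpoch (- 1) (q\<^sup>2) n" for n
  proof -
    have "(\<Prod>j<n. (q\<^sup>2) ^ Suc j - - (q\<^sup>2)) = (\<Prod>j<n. q\<^sup>2 * (1 - - 1 * (q\<^sup>2) ^ j))"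
      by (intro prod.cong) (simp_all add: algebra_simps)
    also have "\<dots> = (q\<^sup>2) ^ n * qpoch (- 1) (q\<^sup>2) n"
      by (simp only: prod.distrib qpoch_def prod_constant card_lessThan)
    finally have "v n = (- 1 / q) ^ n * (q\<^sup>2) ^ n * qpoch (- 1) (q\<^sup>2) n"
      by (simp add: v_def bilateral_neg_def)
    also have "(- 1 / q) ^ n * (q\<^sup>2) ^ n = (- q) ^ n"
      unfolding power_mult_distrib[symmetric] using q by (simp add: power2_eq_square)
    finally show ?thesis .
  qed
  have step: "(- (q ^ 3)) ^ k * qpoch (- 1) (q\<^sup>2) k = - (1 / q) * v (Suc k) - v k" for k
  proof -
    have "(- (q ^ 3)) ^ k = (- q) ^ k * (q\<^sup>2) ^ k"
      unfolding power_mult_distrib[symmetric] by (simp add: power2_eq_square power3_eq_cube mult.assoc)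
    moreover have "- (1 / q) * v (Suc k) = v k * (1 + (q\<^sup>2) ^ k)"
      unfolding v using q by (simp add: qpoch_Suc)
    ultimately show ?thesis
      by (simp add: v[of k] algebra_simps)
  qed
  have "v sums ((\<Sum>n. v (Suc n)) + v 0)"
    using summable_sums[OF sv] by (simp add: sums_Suc_iff)
  hence "(\<lambda>k. - (1 / q) * v (Suc k) - v k) sums (- (1 / q) * (\<Sum>n. v (Suc n)) - ((\<Sum>n. v (Suc n)) + v 0))"
    by (intro sums_diff sums_mult summable_sums sv)
  moreover have "- (1 / q) * N - (N + v 0) = - (1 + 1 / q) * N - 1" for N
    by (simp add: v algebra_simps)
  ultimately show ?thesis
    unfolding step by (simp only: v_def)
qed

lemma qpoch_inf_quotient:
  "qpoch_inf (q\<^sup>2) (q\<^sup>2) / (qpoch_inf (- (q\<^sup>2)) (q\<^sup>2) * qpoch_inf (- q) (q\<^sup>2)) = qpoch_inf q q"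
proof -
  have 1: "qpoch_inf (- q) q = qpoch_inf (- q) (q\<^sup>2) * qpoch_inf (- (q\<^sup>2)) (q\<^sup>2)"
    using qpoch_inf_even_odd[OF q(2), of "- q"] by (simp add: power2_eq_square)
  have "qpoch_inf (- q) q \<noteq> 0"
    using qpoch_inf_odd_inverse[OF q] by auto
  thus ?thesis
    unfolding qpoch_inf_square[OF q(2)] 1 by (simp add: field_simps)
qed

text \<open>The series is symmetric in the parameters \<open>a, b\<close> of \<open>heine_sum\<close>, which is applied with
  \<open>(a, b) = (-1, -1/q)\<close> and \<open>(-1/q, -1)\<close>. The Lambert series enter the two evaluations with
  opposite signs, so averaging eliminates them.\<close>

lemma heine_sum_evaluation:
  "(\<lambda>n. qpoch (q\<^sup>2) (q\<^sup>2) n * (q\<^sup>2) ^ n / (qpoch (- q) (q\<^sup>2) n * qpoch (- (q\<^sup>2)) (q\<^sup>2) n)) sums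
    ((3 - q) / 2 - qpoch_inf q q * ((1 + q) * ((\<Sum>n. bilateral_pos q (- (q\<^sup>2)) n) -
      (\<Sum>n. bilateral_neg q (- (q\<^sup>2)) (Suc n))) / 2 - q))"
  (is "?f sums _")
proof -
  define \<phi> where "\<phi> = (\<Sum>n. bilateral_pos q (- (q\<^sup>2)) n)"
  define \<nu> where "\<nu> = (\<Sum>n. bilateral_neg q (- (q\<^sup>2)) (Suc n))"
  define e where "e = qpoch_inf q q"
  obtain s where s1: "(\<lambda>j. (-1) ^ j * q ^ (2 * j + 1) / (1 + q ^ (2 * j + 1))) sums s"
    and s2: "(\<lambda>n. (-1) ^ n * q ^ (n + 1) / (1 + (q\<^sup>2) ^ (n + 1))) sums s"
    using lambert_sums_eq[OF q(2)] by blast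
  have q1: "1 + q \<noteq> 0"
    using q by (auto simp: add_eq_0_iff)
  define L1 where "L1 = (\<Sum>k. (q\<^sup>2 / - 1) ^ k / (1 - - 1 / q * (q\<^sup>2) ^ k))"
  define L2 where "L2 = (\<Sum>k. (q\<^sup>2 / (- 1 / q)) ^ k / (1 - - 1 * (q\<^sup>2) ^ k))"
  have r1: "norm (q\<^sup>2 / - 1) < 1" and r2: "norm (q\<^sup>2 / (- 1 / q)) < 1"
    using q base_facts(1) power_Suc_less_one[of "norm q" 2]
    by (simp_all add: norm_mult norm_power norm_divide power2_eq_square power3_eq_cube mult.assoc)
  have np1: "- 1 * q\<^sup>2 * (q\<^sup>2) ^ k \<noteq> 1" and np2: "- 1 / q * q\<^sup>2 * (q\<^sup>2) ^ k \<noteq> 1" for k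
    using nonpole_minus_1[of "Suc k"] nonpole_minus_inverse[of "Suc k"] by (simp_all add: mult_ac)
  have simps: "- 1 * q\<^sup>2 = - (q\<^sup>2)" "- 1 / q * q\<^sup>2 = - q" "q\<^sup>2 / - 1 = - (q\<^sup>2)" "q\<^sup>2 / (- 1 / q) = - (q ^ 3)"
    using q by (simp_all add: power2_eq_square power3_eq_cube)
  note h1 = heine_sum[OF base_facts(1) r1 _ np1 nonpole_minus_inverse, folded L1_def]
  note h2 = heine_sum[OF base_facts(1) r2 _ np2 nonpole_minus_1, folded L2_def]
  have P: "c * qpoch_inf (q\<^sup>2) (q\<^sup>2) / (qpoch_inf (- (q\<^sup>2)) (q\<^sup>2) * qpoch_inf (- q) (q\<^sup>2)) = c * e"
    and P': "c * qpoch_inf (q\<^sup>2) (q\<^sup>2) / (qpoch_inf (- q) (q\<^sup>2) * qpoch_inf (- (q\<^sup>2)) (q\<^sup>2)) = c * e" for c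
    using qpoch_inf_quotient by (simp_all only: times_divide_eq_right[symmetric] e_def mult.commute)
  have "?f sums ((1 - - 1 / q) * (1 - 1 / - 1) * L1 + 1 / - 1 * e * ((1 + q) * \<phi> - q))"
    using h1 unfolding simps P sums_unique[OF fine_sum_phi3, symmetric] \<phi>_def
    by (simp only: mult.commute[of "qpoch (- (q\<^sup>2)) (q\<^sup>2) _" "qpoch (- q) (q\<^sup>2) _"]) simp
  moreover have "?f sums ((1 - - 1) * (1 - 1 / (- 1 / q)) * L2 + 1 / (- 1 / q) * e * (- (1 + 1 / q) * \<nu> - 1))"
    using h2 q unfolding simps P' sums_unique[OF fine_sum_psi, symmetric] \<nu>_def by simp
  ultimately have sums: "?f sums suminf ?f"
    "suminf ?f = 2 * (1 + 1 / q) * L1 - e * ((1 + q) * \<phi> - q)"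
    "suminf ?f = 2 * (1 + q) * L2 - q * e * (- (1 + 1 / q) * \<nu> - 1)"
    using sums_unique[of ?f] by (auto simp: sums_iff)
  \<comment> \<open>The term of index 0 is 1 / (1 + 1/q) = q / (1 + q); the remaining terms are
    \<open>- q\<close> times the first form of the Lambert series.\<close>
  have L1: "L1 = q / (1 + q) - q * s"
  proof -
    have "(q\<^sup>2 / - 1) ^ Suc k / (1 - - 1 / q * (q\<^sup>2) ^ Suc k) =
        - q * ((-1) ^ k * q ^ (2 * k + 1) / (1 + q ^ (2 * k + 1)))" for k
    proof -
      have 1: "1 - - 1 / q * (q\<^sup>2) ^ Suc k = 1 + q ^ (2 * k + 1)"
        using q by (simp add: power2_eq_square power_mult)
      have 2: "(q\<^sup>2 / - 1) ^ Suc k = - q * ((-1) ^ k * q ^ (2 * k + 1))"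
        unfolding simps(3) by (simp add: power_minus[of "q * q"] power_mult power2_eq_square)
      show ?thesis
        unfolding 1 2 by simp
    qed
    hence "(\<lambda>k. (q\<^sup>2 / - 1) ^ Suc k / (1 - - 1 / q * (q\<^sup>2) ^ Suc k)) sums (- q * s)"
      using sums_mult[OF s1, of "- q"] by simp
    hence "(\<lambda>k. (q\<^sup>2 / - 1) ^ k / (1 - - 1 / q * (q\<^sup>2) ^ k)) sums (- q * s + 1 / (1 - - 1 / q * 1))"
      by (subst (asm) sums_Suc_iff) simp
    thus ?thesis
      unfolding L1_def using q q1 by (simp add: sums_iff field_simps)
  qed
  \<comment> \<open>The splitting y / (1 + y) = 1 - 1 / (1 + y) with y = (q^2)^n lowers the ratio
    from \<open>- (q ^ 3)\<close> to \<open>- q\<close>. It leaves a geometric series minus the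
    second form of the Lambert series, whose extra initial term is 1/2.\<close>
  have L2: "L2 = 1 / (1 + q) - 1 / 2 + s"
  proof -
    have "(\<lambda>n. (- q) ^ Suc n / (1 + (q\<^sup>2) ^ Suc n)) sums (- s)"
      using sums_minus[OF s2] by (simp add: power_minus[of q] mult.left_commute)
    hence "(\<lambda>n. (- q) ^ n / (1 + (q\<^sup>2) ^ n)) sums (- s + 1 / 2)"
      by (subst (asm) sums_Suc_iff) simp
    moreover have "(\<lambda>n. (- q) ^ n) sums (1 / (1 - - q))"
      using q by (intro geometric_sums) simp
    ultimately have "(\<lambda>n. (- q) ^ n - (- q) ^ n / (1 + (q\<^sup>2) ^ n)) sums (1 / (1 - - q) - (- s + 1 / 2))"
      by (intro sums_diff)
    moreover have "(- q) ^ n - (- q) ^ n / (1 + (q\<^sup>2) ^ n) =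
        (q\<^sup>2 / (- 1 / q)) ^ n / (1 - - 1 * (q\<^sup>2) ^ n)" for n
    proof -
      have "(- (q ^ 3)) ^ n = (- q) ^ n * (q\<^sup>2) ^ n"
        unfolding power_mult_distrib[symmetric] by (simp add: power2_eq_square power3_eq_cube mult.assoc)
      moreover have "1 + (q\<^sup>2) ^ n \<noteq> 0"
        using nonpole_minus_1[of n] by (auto simp: add_eq_0_iff)
      ultimately show ?thesis
        unfolding simps(4) by (simp add: field_simps)
    qed
    ultimately show ?thesis
      unfolding L2_def by (simp add: sums_iff)
  qed
  have "(1 + 1 / q) * L1 = ((1 + 1 / q) * q) / (1 + q) - ((1 + 1 / q) * q) * s"
    unfolding L1 by (simp add: right_diff_distrib)
  also have "(1 + 1 / q) * q = 1 + q"
    using q by (simp add: field_simps)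
  finally have L1': "(1 + 1 / q) * L1 = 1 - (1 + q) * s"
    using q1 by simp
  have 1: "2 * (1 + 1 / q) * L1 = 2 - 2 * (1 + q) * s"
    unfolding mult.assoc L1' by (simp only: right_diff_distrib mult_1_right)
  have "(1 + q) * L2 = (1 + q) / (1 + q) - (1 + q) / 2 + (1 + q) * s"
    unfolding L2 by (simp add: right_diff_distrib distrib_left)
  hence L2': "(1 + q) * L2 = 1 - (1 + q) / 2 + (1 + q) * s"
    using q1 by simp
  have 2: "2 * (1 + q) * L2 = 2 - (1 + q) + 2 * (1 + q) * s"
    unfolding mult.assoc L2' by (simp add: field_simps)
  have 3: "q * e * (- (1 + 1 / q) * \<nu> - 1) = - e * ((1 + q) * \<nu> + q)"
    using q by (simp add: field_simps)
  have AB: "suminf ?f = 2 - 2 * (1 + q) * s - e * ((1 + q) * \<phi> - q)"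
    "suminf ?f = 2 - (1 + q) + 2 * (1 + q) * s + e * ((1 + q) * \<nu> + q)"
    using sums(2,3) unfolding 1 2 3 by simp_all
  \<comment> \<open>On addition \<open>s\<close> cancels, and the rational parts 2 and 2 - (1 + q)
    combine to the 3 - q of the theorem.\<close>
  have "2 * suminf ?f = (2 - 2 * (1 + q) * s - e * ((1 + q) * \<phi> - q)) +
      (2 - (1 + q) + 2 * (1 + q) * s + e * ((1 + q) * \<nu> + q))"
    by (rule trans[OF mult_2 arg_cong2[OF AB]])
  hence "2 * suminf ?f = (3 - q) - e * ((1 + q) * (\<phi> - \<nu>) - 2 * q)"
    by (simp add: algebra_simps)
  moreover have "x = y / 2" if "2 * x = y" for x y :: complex
    using that by auto
  ultimately have "suminf ?f = ((3 - q) - e * ((1 + q) * (\<phi> - \<nu>) - 2 * q)) / 2"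
    by blast
  also have "\<dots> = (3 - q) / 2 - e * ((1 + q) * (\<phi> - \<nu>) / 2 - q)"
    by (simp add: field_simps)
  finally have "suminf ?f = (3 - q) / 2 - e * ((1 + q) * (\<phi> - \<nu>) / 2 - q)" .
  thus ?thesis
    using sums(1) unfolding \<phi>_def \<nu>_def e_def by simp
qed

text \<open>Both products in the denominator are completed to start at their first factor. Since
  (q^2;q^2)_2m = (q;q)_2m (-q;q)_2m, the factor (q;q)_2m cancels, and (-q;q)_2m is split into odd
  and even powers.\<close>

lemma G'_term_eq:
  "q ^ (2 * m + 1) / (qpoch_inf (q ^ (2 * m + 1)) q * qpoch (q ^ (2 * m + 2)) (q\<^sup>2) m) =
    q / qpoch_inf q q *
    (qpoch (q\<^sup>2) (q\<^sup>2) m * (q\<^sup>2) ^ m / (qpoch (- q) (q\<^sup>2) m * qpoch (- (q\<^sup>2)) (q\<^sup>2) m))"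
proof -
  define a b D I where "a = qpoch q (q\<^sup>2) m" and "b = qpoch (q\<^sup>2) (q\<^sup>2) m"
    and "D = qpoch (q ^ (2 * m + 2)) (q\<^sup>2) m" and "I = qpoch_inf (q ^ (2 * m + 1)) q"
  define c d where "c = qpoch (- q) (q\<^sup>2) m" and "d = qpoch (- (q\<^sup>2)) (q\<^sup>2) m"
  have nz: "a \<noteq> 0" "b \<noteq> 0" "c \<noteq> 0" "d \<noteq> 0"
    unfolding a_def b_def c_def d_def using q base_facts(1)
    by (simp_all only: qpoch_nonzero qpower_neq_1 norm_minus_cancel not_False_eq_True)
  have "b * D = qpoch (q\<^sup>2) (q\<^sup>2) (m + m)"
    unfolding qpoch_add b_def D_def power_add[of q "2 * m" 2] power_mult by (simp only: mult.commute)
  also have "\<dots> = qpoch q q (2 * m) * qpoch (- q) q (2 * m)"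
    unfolding qpoch_square by (simp add: mult_2)
  also have "\<dots> = (a * b) * (c * d)"
    unfolding qpoch_even_odd by (simp add: a_def b_def c_def d_def power2_eq_square)
  finally have D: "D = a * c * d"
    using nz by (simp add: mult_ac)
  have "qpoch_inf q q = qpoch q q (2 * m) * I"
    using qpoch_inf_split[OF q(2), of q "2 * m"] by (simp add: I_def mult.commute)
  also have "qpoch q q (2 * m) = a * b"
    unfolding qpoch_even_odd by (simp add: a_def b_def power2_eq_square)
  finally have e: "qpoch_inf q q = a * b * I" .
  have "q ^ (2 * m + 1) / (I * (a * c * d)) = q / (a * b * I) * (b * (q\<^sup>2) ^ m / (c * d))"
    using nz by (simp add: mult_ac flip: power_mult)
  thus ?thesis
    unfolding e D[unfolded D_def] b_def[symmetric] c_def[symmetric] d_def[symmetric] I_def[symmetric] .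
qed

end

text \<open>\<open>suminf\<close> has a value even for divergent series, so convergence of both
  expansions is part of the claim.\<close>

theorem theorem6p1:
  fixes q :: complex
  assumes "norm q < 1"
  shows "summable (\<lambda>n. of_nat (G' n) * q ^ n) \<and>
    summable (\<lambda>m. q ^ (2 * m + 1) /
      (qpoch_inf (q ^ (2 * m + 1)) q * qpoch (q ^ (2 * m + 2)) (q\<^sup>2) m)) \<and>
    (\<Sum>n. of_nat (G' n) * q ^ n) =
      (\<Sum>m. q ^ (2 * m + 1) /
        (qpoch_inf (q ^ (2 * m + 1)) q * qpoch (q ^ (2 * m + 2)) (q\<^sup>2) m)) \<and>
    (\<Sum>n. of_nat (G' n) * q ^ n) =
      q\<^sup>2 - q * (1 + q) * mock_phi3 (- q)
      + q * (3 - q) / (2 * qpoch_inf q q)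
      + q * (1 + q) * qpoch_inf (q\<^sup>2) (q\<^sup>2) / (2 * qpoch_inf (- q) q ^ 3)"
proof -
  obtain s where s: "(\<lambda>n. of_nat (G' n) * q ^ n) sums s"
    "(\<lambda>m. q ^ (2 * m + 1) / (qpoch_inf (q ^ (2 * m + 1)) q * qpoch (q ^ (2 * m + 2)) (q\<^sup>2) m)) sums s"
    using G'_generating_function[OF assms] by blast
  have "s = q\<^sup>2 - q * (1 + q) * mock_phi3 (- q) + q * (3 - q) / (2 * qpoch_inf q q)
      + q * (1 + q) * qpoch_inf (q\<^sup>2) (q\<^sup>2) / (2 * qpoch_inf (- q) q ^ 3)"
  \<comment> \<open>The parameter -1/q and the negative half of the bilateral series involve
    division by \<open>q\<close>; at \<open>q = 0\<close> all terms vanish.\<close>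
  proof (cases "q = 0")
    case True
    thus ?thesis using s(2) by (simp add: sums_iff)
  next
    case False
    note q = False assms
    define \<phi> where "\<phi> = (\<Sum>n. bilateral_pos q (- (q\<^sup>2)) n)"
    define \<nu> where "\<nu> = (\<Sum>n. bilateral_neg q (- (q\<^sup>2)) (Suc n))"
    define e where "e = qpoch_inf q q"
    define \<eta> where "\<eta> = qpoch_inf (q\<^sup>2) (q\<^sup>2) / qpoch_inf (- q) q ^ 3"
    have e: "e \<noteq> 0"
      unfolding e_def using q by (intro qpoch_inf_nonzero qpower_neq_1)
    \<comment> \<open>The sign (-1)^(n^2) equals (-1)^n because n^2 and n have the same
      parity.\<close>
    have phi: "mock_phi3 (- q) = \<phi>"
      unfolding mock_phi3_def \<phi>_def bilateral_pos_def
      by (intro suminf_cong) (simp add: power_minus[of q "_\<^sup>2"] minus_one_power_iff)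
    have "\<phi> + \<nu> = \<eta>"
      using bilateral_eta_quotient[OF q] unfolding bilateral_def \<phi>_def \<nu>_def \<eta>_def .
    hence \<nu>: "\<nu> = \<eta> - \<phi>"
      by (simp add: algebra_simps)
    have "s = q / e * ((3 - q) / 2 - e * ((1 + q) * (\<phi> - \<nu>) / 2 - q))"
      using sums_mult[OF heine_sum_evaluation[OF q], of "q / e"] s(2)
      unfolding G'_term_eq[OF q] e_def \<phi>_def \<nu>_def by (rule sums_unique2[rotated])
    also have "\<dots> = q\<^sup>2 - q * (1 + q) * \<phi> + q * (3 - q) / (2 * e) + q * (1 + q) * \<eta> / 2"
      unfolding \<nu> using e by (simp add: field_simps power2_eq_square)
    finally show ?thesis
      by (simp add: phi e_def \<eta>_def)
  qed
  thus ?thesis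
    using s by (auto simp: sums_iff)
qed

end
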